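(* Let $A$ be a cofree coalgebra over $K$. Define $$\mathcal{DD}(A)=\{(\prec,\succ)\mid (A,\prec,\succ,\Delta)\text{ is a dendriform Hopf algebra}\},$$ $$\mathcal{LI}(A)=\{( *,I)\mid (A,*,\Delta)\text{ is a Hopf algebra and } I \text{ is a left ideal of } (A,* ) \text{ such that } A_+=Prim(A)\oplus I\}.$$ There is a bijection between these two sets, given by $$\Phi_A:\mathcal{DD}(A)\longrightarrow\mathcal{LI}(A),\qquad(\prec,\succ)\longmapsto(\prec+\succ,\;A_+\prec A_+).$$
   Context: $K$ is a commutative field of characteristic zero. A coalgebra is called cofree if it is isomorphic to a tensor coalgebra $T(V)=\bigoplus_{n\ge0}V^{\otimes n}$ ($V$ a vector space) with the deconcatenation coproduct $\Delta(v_1\ldots v_n)=\sum_{i=0}^n v_1\ldots v_i\otimes v_{i+1}\ldots v_n$. The element $1$ of $A$ is its group-like element, which is the unit of the products considered; $A_+$ is the kernel of the counit (augmentation ideal), $A=K1\oplus A_+$; $\tilde\Delta:A_+\to A_+\otimes A_+$ is defined by $\tilde\Delta(a)=\Delta(a)-a\otimes1-1\otimes a$, written $\tilde\Delta(a)=a'\otimes a''$ (summation understood); $Prim(A)=\{a\in A_+\mid\tilde\Delta(a)=0\}$. A dendriform Hopf algebra $(A,\prec,\succ,\Delta)$ is a Hopf algebra $(A,*,\Delta)$ whose product $*$, restricted to $A_+$, is split as $*=\prec+\succ$ with bilinear products $\prec,\succ:A_+\otimes A_+\to A_+$ such that for all $x,y,z\in A_+$: $(x\prec y)\prec z=x\prec(y*z)$,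 $(x\succ y)\prec z=x\succ(y\prec z)$, $(x*y)\succ z=x\succ(y\succ z)$, and for all $a,b\in A_+$: $\tilde\Delta(a\prec b)=a'*b'\otimes a''\prec b''+a'*b\otimes a''+b'\otimes a\prec b''+a'\otimes a''\prec b+b\otimes a$, $\tilde\Delta(a\succ b)=a'*b'\otimes a''\succ b''+a*b'\otimes b''+b'\otimes a\succ b''+a'\otimes a''\succ b+a\otimes b$. In the definition of $\Phi_A$, $\prec+\succ$ denotes the product $*$ on $A$ with unit $1$ which equals $\prec+\succ$ on $A_+$, and $A_+\prec A_+$ is the linear span of the elements $a\prec b$ with $a,b\in A_+$. *)

theory Defs
  imports Complex_Main "HOL-Library.Poly_Mapping" "HOL-Library.FuncSet"
begin

text \<open>
  Elements of tensor products are represented by formal linear combinations, i.e. by elements of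
  the free vector space \<open>'x \<Rightarrow>\<^sub>0 'k\<close> on a type of generators, and equality in the tensor product is
  congruence modulo the subspace of (multi)linear relations.
  The generators are pairs for \<open>A \<otimes> A\<close>, and words \<open>[v\<^sub>1, \<dots>, v\<^sub>n]\<close> for the tensor algebra
  \<open>T(V)\<close>, where the word stands for \<open>v\<^sub>1 \<otimes> \<dots> \<otimes> v\<^sub>n\<close>.
\<close>

definition fscale :: "'k::field \<Rightarrow> ('x \<Rightarrow>\<^sub>0 'k) \<Rightarrow> ('x \<Rightarrow>\<^sub>0 'k)" where
  "fscale c u = Poly_Mapping.map ((*) c) u"

lemma lookup_fscale [simp]: "Poly_Mapping.lookup (fscale c u) x = c * Poly_Mapping.lookup u x"
  unfolding fscale_def by (simp add: Poly_Mapping.map.rep_eq when_def)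

interpretation free: vector_space fscale
  by unfold_locales (rule poly_mapping_eqI; simp add: lookup_add algebra_simps)+

text \<open>The linear extension, to formal linear combinations, of a map defined on generators.\<close>

definition lin_ext :: "('k::field \<Rightarrow> 'b::ab_group_add \<Rightarrow> 'b) \<Rightarrow> ('x \<Rightarrow> 'b) \<Rightarrow> ('x \<Rightarrow>\<^sub>0 'k) \<Rightarrow> 'b" where
  "lin_ext s f u = (\<Sum>x\<in>Poly_Mapping.keys u. s (Poly_Mapping.lookup u x) (f x))"

abbreviation pure_tensor :: "'a \<Rightarrow> 'b \<Rightarrow> ('a \<times> 'b) \<Rightarrow>\<^sub>0 'k::field" (infix "\<otimes>" 72) where
  "x \<otimes> y \<equiv> Poly_Mapping.single (x, y) 1"

abbreviation word :: "'v list \<Rightarrow> ('v list \<Rightarrow>\<^sub>0 'k::field)" where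
  "word w \<equiv> Poly_Mapping.single w 1"

definition tensor_null ::
    "('k::field \<Rightarrow> 'a::ab_group_add \<Rightarrow> 'a) \<Rightarrow> (('a \<times> 'a) \<Rightarrow>\<^sub>0 'k) set" where
  "tensor_null s = free.span
     ({(x + y) \<otimes> z - x \<otimes> z - y \<otimes> z | x y z. True} \<union>
      {x \<otimes> (y + z) - x \<otimes> y - x \<otimes> z | x y z. True} \<union>
      {(s c x) \<otimes> y - fscale c (x \<otimes> y) | c x y. True} \<union>
      {x \<otimes> (s c y) - fscale c (x \<otimes> y) | c x y. True})"

definition tensor_eq ::
    "('k::field \<Rightarrow> 'a::ab_group_add \<Rightarrow> 'a) \<Rightarrow> (('a \<times> 'a) \<Rightarrow>\<^sub>0 'k) \<Rightarrow> (('a \<times> 'a) \<Rightarrow>\<^sub>0 'k) \<Rightarrow> bool" where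
  "tensor_eq s u v \<longleftrightarrow> u - v \<in> tensor_null s"

definition tensor_alg_null ::
    "('k::field \<Rightarrow> 'v::ab_group_add \<Rightarrow> 'v) \<Rightarrow> ('v list \<Rightarrow>\<^sub>0 'k) set" where
  "tensor_alg_null s = free.span
     ({word (p @ [x + y] @ q) - word (p @ [x] @ q) - word (p @ [y] @ q) | p q x y. True} \<union>
      {word (p @ [s c x] @ q) - fscale c (word (p @ [x] @ q)) | p q c x. True})"

definition tensor_alg_eq ::
    "('k::field \<Rightarrow> 'v::ab_group_add \<Rightarrow> 'v) \<Rightarrow> ('v list \<Rightarrow>\<^sub>0 'k) \<Rightarrow> ('v list \<Rightarrow>\<^sub>0 'k) \<Rightarrow> bool" where
  "tensor_alg_eq s u v \<longleftrightarrow> u - v \<in> tensor_alg_null s"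

definition bilinear_on ::
    "('k::field \<Rightarrow> 'a::ab_group_add \<Rightarrow> 'a) \<Rightarrow> 'a set \<Rightarrow> ('a \<Rightarrow> 'a \<Rightarrow> 'a) \<Rightarrow> bool" where
  "bilinear_on s S m \<longleftrightarrow> (\<forall>x\<in>S. \<forall>y\<in>S. \<forall>z\<in>S. \<forall>c.
     m (x + y) z = m x z + m y z \<and> m x (y + z) = m x y + m x z \<and>
     m (s c x) y = s c (m x y) \<and> m x (s c y) = s c (m x y))"

text \<open>
  The map \<open>\<Delta>\<close> picks, for every element, a formal sum representing its coproduct, hence all
  conditions on it are only required modulo the relations. Coassociativity is an equation in
  \<open>A \<otimes> A \<otimes> A\<close>, which is the part of degree three of \<open>T(A)\<close>.
\<close>

locale coalgebra = vector_space scale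
  for scale :: "'k::field \<Rightarrow> 'a::ab_group_add \<Rightarrow> 'a" +
  fixes \<Delta> :: "'a \<Rightarrow> ('a \<times> 'a) \<Rightarrow>\<^sub>0 'k"
    and \<epsilon> :: "'a \<Rightarrow> 'k"
  assumes coproduct_add: "tensor_eq scale (\<Delta> (a + b)) (\<Delta> a + \<Delta> b)"
    and coproduct_scale: "tensor_eq scale (\<Delta> (scale c a)) (fscale c (\<Delta> a))"
    and counit_linear: "Vector_Spaces.linear scale (*) \<epsilon>"
    and coassoc: "tensor_alg_eq scale
      (lin_ext fscale (\<lambda>(x, y). lin_ext fscale (\<lambda>(x', x''). word [x', x'', y]) (\<Delta> x)) (\<Delta> a))
      (lin_ext fscale (\<lambda>(x, y). lin_ext fscale (\<lambda>(y', y''). word [x, y', y'']) (\<Delta> y)) (\<Delta> a))"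
    and counit_left: "lin_ext scale (\<lambda>(x, y). scale (\<epsilon> x) y) (\<Delta> a) = a"
    and counit_right: "lin_ext scale (\<lambda>(x, y). scale (\<epsilon> y) x) (\<Delta> a) = a"
begin

text \<open>
  The map \<open>\<phi>\<close> below induces a linear isomorphism from \<open>T(V)\<close> to \<open>A\<close>, since it is onto and its
  kernel consists of the multilinear relations. Words span \<open>T(V)\<close>, so compatibility with
  deconcatenation only has to be required on them.
\<close>

definition cofree_on :: "('k \<Rightarrow> 'v::ab_group_add \<Rightarrow> 'v) \<Rightarrow> bool" where
  "cofree_on vscale \<longleftrightarrow> vector_space vscale \<and>
     (\<exists>\<phi> :: ('v list \<Rightarrow>\<^sub>0 'k) \<Rightarrow> 'a.
        Vector_Spaces.linear fscale scale \<phi> \<and> surj \<phi> \<and>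
        {u. \<phi> u = 0} = tensor_alg_null vscale \<and>
        (\<forall>w. tensor_eq scale (\<Delta> (\<phi> (word w)))
               (\<Sum>i\<le>length w. \<phi> (word (take i w)) \<otimes> \<phi> (word (drop i w)))) \<and>
        (\<forall>w. \<epsilon> (\<phi> (word w)) = (if w = [] then 1 else 0)))"

definition group_like :: "'a \<Rightarrow> bool" where
  "group_like g \<longleftrightarrow> tensor_eq scale (\<Delta> g) (g \<otimes> g) \<and> \<epsilon> g = 1"

end

locale hopf_algebra = coalgebra scale \<Delta> \<epsilon>
  for scale :: "'k::field \<Rightarrow> 'a::ab_group_add \<Rightarrow> 'a" and \<Delta> \<epsilon> +
  fixes e :: 'a
    and mult :: "'a \<Rightarrow> 'a \<Rightarrow> 'a" (infixl "\<star>" 75)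
  assumes mult_bilinear: "bilinear_on scale UNIV (\<star>)"
    and mult_assoc: "(a \<star> b) \<star> c = a \<star> (b \<star> c)"
    and unit_left: "e \<star> a = a"
    and unit_right: "a \<star> e = a"
    and coproduct_unit: "tensor_eq scale (\<Delta> e) (e \<otimes> e)"
    and counit_unit: "\<epsilon> e = 1"
    and coproduct_mult: "tensor_eq scale (\<Delta> (a \<star> b))
      (lin_ext fscale (\<lambda>(a', a''). lin_ext fscale (\<lambda>(b', b''). (a' \<star> b') \<otimes> (a'' \<star> b'')) (\<Delta> b)) (\<Delta> a))"
    and counit_mult: "\<epsilon> (a \<star> b) = \<epsilon> a * \<epsilon> b"
    and antipode: "\<exists>S. Vector_Spaces.linear scale scale S \<and>
      (\<forall>a. lin_ext scale (\<lambda>(x, y). S x \<star> y) (\<Delta> a) = scale (\<epsilon> a) e \<and>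
           lin_ext scale (\<lambda>(x, y). x \<star> S y) (\<Delta> a) = scale (\<epsilon> a) e)"

definition augmentation_ideal :: "('a \<Rightarrow> 'k::zero) \<Rightarrow> 'a set" where
  "augmentation_ideal \<epsilon> = {a. \<epsilon> a = 0}"

definition reduced_coproduct ::
    "('a \<Rightarrow> ('a \<times> 'a) \<Rightarrow>\<^sub>0 'k::field) \<Rightarrow> 'a \<Rightarrow> 'a \<Rightarrow> ('a \<times> 'a) \<Rightarrow>\<^sub>0 'k" where
  "reduced_coproduct \<Delta> e a = \<Delta> a - a \<otimes> e - e \<otimes> a"

definition primitives ::
    "('k::field \<Rightarrow> 'a::ab_group_add \<Rightarrow> 'a) \<Rightarrow> ('a \<Rightarrow> ('a \<times> 'a) \<Rightarrow>\<^sub>0 'k) \<Rightarrow>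
     ('a \<Rightarrow> 'k) \<Rightarrow> 'a \<Rightarrow> 'a set" where
  "primitives scale \<Delta> \<epsilon> e =
     {a \<in> augmentation_ideal \<epsilon>. tensor_eq scale (reduced_coproduct \<Delta> e a) 0}"

text \<open>
  A Sweedler representation \<open>a' \<otimes> a''\<close> of the reduced coproduct of \<open>a\<close>, with all \<open>a'\<close> and \<open>a''\<close>
  in the augmentation ideal (the half-products are only meaningful there). For \<open>a\<close> in the
  augmentation ideal and \<open>e\<close> group-like such a representation exists: by the counit axioms, replace
  each \<open>x \<otimes> y\<close> in \<open>\<Delta>(a)\<close> by \<open>(x - \<epsilon>(x) e) \<otimes> (y - \<epsilon>(y) e)\<close>. Multilinear expressions in it do
  not depend on its choice, so identities below are stated for every representation.
\<close>

definition sweedler_rep ::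
    "('k::field \<Rightarrow> 'a::ab_group_add \<Rightarrow> 'a) \<Rightarrow> ('a \<Rightarrow> ('a \<times> 'a) \<Rightarrow>\<^sub>0 'k) \<Rightarrow>
     ('a \<Rightarrow> 'k) \<Rightarrow> 'a \<Rightarrow> 'a \<Rightarrow> (('a \<times> 'a) \<Rightarrow>\<^sub>0 'k) \<Rightarrow> bool" where
  "sweedler_rep scale \<Delta> \<epsilon> e a u \<longleftrightarrow>
     Poly_Mapping.keys u \<subseteq> augmentation_ideal \<epsilon> \<times> augmentation_ideal \<epsilon> \<and>
     tensor_eq scale u (reduced_coproduct \<Delta> e a)"

text \<open>
  The half-products are functions on the augmentation ideal, extended by \<open>undefined\<close>, so that
  they are determined by their values there.
\<close>

locale dendriform_hopf_algebra = hopf_algebra scale \<Delta> \<epsilon> e mult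
  for scale :: "'k::field \<Rightarrow> 'a::ab_group_add \<Rightarrow> 'a" and \<Delta> \<epsilon> e
    and mult :: "'a \<Rightarrow> 'a \<Rightarrow> 'a" (infixl "\<star>" 75) +
  fixes prec :: "'a \<Rightarrow> 'a \<Rightarrow> 'a" (infixl "\<lhd>" 75)
    and succ :: "'a \<Rightarrow> 'a \<Rightarrow> 'a" (infixl "\<rhd>" 75)
  assumes prec_closed:
      "(\<lhd>) \<in> augmentation_ideal \<epsilon> \<rightarrow>\<^sub>E augmentation_ideal \<epsilon> \<rightarrow>\<^sub>E augmentation_ideal \<epsilon>"
    and succ_closed:
      "(\<rhd>) \<in> augmentation_ideal \<epsilon> \<rightarrow>\<^sub>E augmentation_ideal \<epsilon> \<rightarrow>\<^sub>E augmentation_ideal \<epsilon>"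
    and prec_bilinear: "bilinear_on scale (augmentation_ideal \<epsilon>) (\<lhd>)"
    and succ_bilinear: "bilinear_on scale (augmentation_ideal \<epsilon>) (\<rhd>)"
    and mult_split: "\<lbrakk>a \<in> augmentation_ideal \<epsilon>; b \<in> augmentation_ideal \<epsilon>\<rbrakk> \<Longrightarrow>
      a \<star> b = a \<lhd> b + a \<rhd> b"
    and prec_prec: "\<lbrakk>x \<in> augmentation_ideal \<epsilon>; y \<in> augmentation_ideal \<epsilon>; z \<in> augmentation_ideal \<epsilon>\<rbrakk> \<Longrightarrow>
      (x \<lhd> y) \<lhd> z = x \<lhd> (y \<star> z)"
    and succ_prec: "\<lbrakk>x \<in> augmentation_ideal \<epsilon>; y \<in> augmentation_ideal \<epsilon>; z \<in> augmentation_ideal \<epsilon>\<rbrakk> \<Longrightarrow>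
      (x \<rhd> y) \<lhd> z = x \<rhd> (y \<lhd> z)"
    and mult_succ: "\<lbrakk>x \<in> augmentation_ideal \<epsilon>; y \<in> augmentation_ideal \<epsilon>; z \<in> augmentation_ideal \<epsilon>\<rbrakk> \<Longrightarrow>
      (x \<star> y) \<rhd> z = x \<rhd> (y \<rhd> z)"
    and coproduct_prec:
      "\<lbrakk>a \<in> augmentation_ideal \<epsilon>; b \<in> augmentation_ideal \<epsilon>;
        sweedler_rep scale \<Delta> \<epsilon> e a u; sweedler_rep scale \<Delta> \<epsilon> e b v\<rbrakk> \<Longrightarrow>
      tensor_eq scale (reduced_coproduct \<Delta> e (a \<lhd> b))
        (lin_ext fscale (\<lambda>(a', a''). lin_ext fscale (\<lambda>(b', b''). (a' \<star> b') \<otimes> (a'' \<lhd> b'')) v) u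
         + lin_ext fscale (\<lambda>(a', a''). (a' \<star> b) \<otimes> a'') u
         + lin_ext fscale (\<lambda>(b', b''). b' \<otimes> (a \<lhd> b'')) v
         + lin_ext fscale (\<lambda>(a', a''). a' \<otimes> (a'' \<lhd> b)) u
         + b \<otimes> a)"
    and coproduct_succ:
      "\<lbrakk>a \<in> augmentation_ideal \<epsilon>; b \<in> augmentation_ideal \<epsilon>;
        sweedler_rep scale \<Delta> \<epsilon> e a u; sweedler_rep scale \<Delta> \<epsilon> e b v\<rbrakk> \<Longrightarrow>
      tensor_eq scale (reduced_coproduct \<Delta> e (a \<rhd> b))
        (lin_ext fscale (\<lambda>(a', a''). lin_ext fscale (\<lambda>(b', b''). (a' \<star> b') \<otimes> (a'' \<rhd> b'')) v) u
         + lin_ext fscale (\<lambda>(b', b''). (a \<star> b') \<otimes> b'') v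
         + lin_ext fscale (\<lambda>(b', b''). b' \<otimes> (a \<rhd> b'')) v
         + lin_ext fscale (\<lambda>(a', a''). a' \<otimes> (a'' \<rhd> b)) u
         + a \<otimes> b)"

definition DD ::
    "('k::field \<Rightarrow> 'a::ab_group_add \<Rightarrow> 'a) \<Rightarrow> ('a \<Rightarrow> ('a \<times> 'a) \<Rightarrow>\<^sub>0 'k) \<Rightarrow>
     ('a \<Rightarrow> 'k) \<Rightarrow> 'a \<Rightarrow> (('a \<Rightarrow> 'a \<Rightarrow> 'a) \<times> ('a \<Rightarrow> 'a \<Rightarrow> 'a)) set" where
  "DD scale \<Delta> \<epsilon> e =
     {(prec, succ). \<exists>mult. dendriform_hopf_algebra scale \<Delta> \<epsilon> e mult prec succ}"

definition left_ideal ::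
    "('k::field \<Rightarrow> 'a::ab_group_add \<Rightarrow> 'a) \<Rightarrow> ('a \<Rightarrow> 'a \<Rightarrow> 'a) \<Rightarrow> 'a set \<Rightarrow> bool" where
  "left_ideal scale mult I \<longleftrightarrow> module.subspace scale I \<and> (\<forall>a. \<forall>x\<in>I. mult a x \<in> I)"

definition LI ::
    "('k::field \<Rightarrow> 'a::ab_group_add \<Rightarrow> 'a) \<Rightarrow> ('a \<Rightarrow> ('a \<times> 'a) \<Rightarrow>\<^sub>0 'k) \<Rightarrow>
     ('a \<Rightarrow> 'k) \<Rightarrow> 'a \<Rightarrow> (('a \<Rightarrow> 'a \<Rightarrow> 'a) \<times> 'a set) set" where
  "LI scale \<Delta> \<epsilon> e =
     {(mult, I). hopf_algebra scale \<Delta> \<epsilon> e mult \<and> left_ideal scale mult I \<and>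
        augmentation_ideal \<epsilon> = {p + x | p x. p \<in> primitives scale \<Delta> \<epsilon> e \<and> x \<in> I} \<and>
        primitives scale \<Delta> \<epsilon> e \<inter> I = {0}}"

text \<open>
  The product with unit \<open>e\<close> equal to \<open>\<prec> + \<succ>\<close> on the augmentation ideal: here
  \<open>a = \<epsilon>(a) e + (a - \<epsilon>(a) e)\<close> is the decomposition along \<open>A = K e \<oplus> A\<^sub>+\<close>.
\<close>

definition unital_sum ::
    "('k::field \<Rightarrow> 'a::ab_group_add \<Rightarrow> 'a) \<Rightarrow> ('a \<Rightarrow> 'k) \<Rightarrow> 'a \<Rightarrow>
     ('a \<Rightarrow> 'a \<Rightarrow> 'a) \<Rightarrow> ('a \<Rightarrow> 'a \<Rightarrow> 'a) \<Rightarrow> 'a \<Rightarrow> 'a \<Rightarrow> 'a" where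
  "unital_sum scale \<epsilon> e prec succ a b =
     (let a\<^sub>0 = a - scale (\<epsilon> a) e; b\<^sub>0 = b - scale (\<epsilon> b) e
      in scale (\<epsilon> a * \<epsilon> b) e + scale (\<epsilon> a) b\<^sub>0 + scale (\<epsilon> b) a\<^sub>0 + (prec a\<^sub>0 b\<^sub>0 + succ a\<^sub>0 b\<^sub>0))"

definition \<Phi> ::
    "('k::field \<Rightarrow> 'a::ab_group_add \<Rightarrow> 'a) \<Rightarrow> ('a \<Rightarrow> 'k) \<Rightarrow> 'a \<Rightarrow>
     ('a \<Rightarrow> 'a \<Rightarrow> 'a) \<times> ('a \<Rightarrow> 'a \<Rightarrow> 'a) \<Rightarrow> ('a \<Rightarrow> 'a \<Rightarrow> 'a) \<times> 'a set" where
  "\<Phi> scale \<epsilon> e = (\<lambda>(prec, succ). (unital_sum scale \<epsilon> e prec succ,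
     module.span scale
       {prec a b | a b. a \<in> augmentation_ideal \<epsilon> \<and> b \<in> augmentation_ideal \<epsilon>}))"

end

theory Submission
  imports Defs
begin

text \<open>
  Let \<open>\<pi>\<close> be the projection of \<open>A\<close> onto its primitive elements with kernel \<open>K 1 \<oplus> I\<close>. Since \<open>A\<close> is
  cofree, \<open>(id \<otimes> \<pi>) \<circ> \<Delta>\<close> restricts to an isomorphism from the augmentation ideal onto
  \<open>A \<otimes> Prim(A)\<close>; write \<open>R c v\<close> for the preimage of \<open>c \<otimes> v\<close> (in \<open>T(V)\<close>, with \<open>I\<close> the words of length
  at least two, this is the word \<open>c\<close> followed by the letter \<open>v\<close>). Comparing coproducts shows that a
  left half-product with \<open>A\<^sub>+ \<prec> A\<^sub>+ = I\<close> must satisfy \<open>v \<prec> c = R c v\<close> for primitive \<open>v\<close>, hence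
  \<open>R c v \<prec> b = R (c * b) v\<close>. This determines it from the product and \<open>I\<close>, and conversely this formula
  defines it; that \<open>I\<close> is a left ideal is exactly what the axiom
  \<open>(x \<succ> y) \<prec> z = x \<succ> (y \<prec> z)\<close> needs. For a given dendriform structure, \<open>A\<^sub>+ \<prec> A\<^sub>+\<close> is a complement of
  \<open>Prim(A)\<close> because \<open>c \<otimes> v \<mapsto> v \<prec> c\<close>, followed by \<open>id \<otimes> \<pi>\<^sub>0\<close> on the coproduct with any projection
  \<open>\<pi>\<^sub>0\<close>, is unitriangular with respect to the length of words.
\<close>

section \<open>Linear maps between spaces given by explicit scalar multiplications\<close>

abbreviation lin where "lin \<equiv> Vector_Spaces.linear"

lemma lin_add: "lin s t f \<Longrightarrow> f (x + y) = f x + f y"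
  by (simp add: Vector_Spaces.linear_iff)

lemma lin_scale: "lin s t f \<Longrightarrow> f (s c x) = t c (f x)"
  by (simp add: Vector_Spaces.linear_iff)

lemma lin_zero: "lin s t f \<Longrightarrow> f 0 = 0"
  by (metis add_cancel_right_right lin_add)

lemma lin_diff: "lin s t f \<Longrightarrow> f (x - y) = f x - f y"
  by (metis add_diff_cancel_right' diff_add_cancel lin_add)

lemma lin_sum: "lin s t f \<Longrightarrow> f (\<Sum>x\<in>X. g x) = (\<Sum>x\<in>X. f (g x))"
  by (induction X rule: infinite_finite_induct) (auto simp: lin_zero lin_add)

lemma linI:
  assumes "vector_space s" "vector_space t"
    "\<And>x y. f (x + y) = f x + f y" "\<And>c x. f (s c x) = t c (f x)"
  shows "lin s t f"
  using assms by (simp add: Vector_Spaces.linear_iff)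

lemma lin_vs: "lin s t f \<Longrightarrow> vector_space s" "lin s t f \<Longrightarrow> vector_space t"
  by (auto simp: Vector_Spaces.linear_iff)

lemma lin_ident: "vector_space s \<Longrightarrow> lin s s (\<lambda>x. x)"
  by (rule linI) auto

lemma lin_comp: "lin s t f \<Longrightarrow> lin t r g \<Longrightarrow> lin s r (\<lambda>x. g (f x))"
  by (auto simp: Vector_Spaces.linear_iff)

lemma
  assumes "vector_space s"
  shows vs_add: "s c (x + y) = s c x + s c y"
    and vs_diff: "s c (x - y) = s c x - s c y"
    and vs_add_left: "s (c + d) x = s c x + s d x"
    and vs_assoc: "s c (s d x) = s (c * d) x"
    and vs_one: "s 1 x = x"
    and vs_zero: "s 0 x = 0"
    and vs_zero_right: "s c 0 = 0"
    and vs_sum: "s c (\<Sum>x\<in>X. g x) = (\<Sum>x\<in>X. s c (g x))"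
proof -
  interpret vector_space s by fact
  show "s c (x + y) = s c x + s c y" "s c (x - y) = s c x - s c y"
    "s (c + d) x = s c x + s d x" "s c (s d x) = s (c * d) x"
    "s 1 x = x" "s 0 x = 0" "s c 0 = 0" "s c (\<Sum>x\<in>X. g x) = (\<Sum>x\<in>X. s c (g x))"
    by (simp_all add: scale_right_distrib scale_right_diff_distrib scale_left_distrib scale_sum_right)
qed

lemma lin_const0: "vector_space s \<Longrightarrow> vector_space t \<Longrightarrow> lin s t (\<lambda>x. 0)"
  by (rule linI) (auto simp: vs_zero_right)

lemma lin_plus: "lin s t f \<Longrightarrow> lin s t g \<Longrightarrow> lin s t (\<lambda>x. f x + g x)"
  using lin_vs[of s t f] by (intro linI) (auto simp: lin_add lin_scale vs_add)

lemma lin_minus: "lin s t f \<Longrightarrow> lin s t g \<Longrightarrow> lin s t (\<lambda>x. f x - g x)"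
  using lin_vs[of s t f] by (intro linI) (auto simp: lin_add lin_scale vs_diff)

lemma lin_scaled: "lin s t f \<Longrightarrow> lin s t (\<lambda>x. t c (f x))"
  using lin_vs[of s t f] by (intro linI) (auto simp: lin_add lin_scale vs_add vs_assoc mult.commute)

lemma lin_functional_scaled: "lin s (*) f \<Longrightarrow> vector_space t \<Longrightarrow> lin s t (\<lambda>x. t (f x) w)"
  using lin_vs[of s "(*)" f] by (intro linI) (auto simp: lin_add lin_scale vs_add_left vs_assoc)

lemma vs_field: "vector_space ((*) :: 'k::field \<Rightarrow> 'k \<Rightarrow> 'k)"
  by unfold_locales (auto simp: algebra_simps)

lemma vs_free: "vector_space (fscale :: 'k::field \<Rightarrow> ('x \<Rightarrow>\<^sub>0 'k) \<Rightarrow> _)"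
  by (rule free.vector_space_axioms)

subsection \<open>Linear extension\<close>

text \<open>Passing to a common finite index set lets the sums of two formal combinations be added
  termwise.\<close>

lemma lin_ext_superset:
  assumes "vector_space t" "finite X" "Poly_Mapping.keys u \<subseteq> X"
  shows "lin_ext t f u = (\<Sum>x\<in>X. t (Poly_Mapping.lookup u x) (f x))"
  unfolding lin_ext_def
  by (rule sum.mono_neutral_left) (use assms in \<open>auto simp: in_keys_iff vs_zero\<close>)

lemma lin_lin_ext:
  fixes t :: "'k::field \<Rightarrow> 'b::ab_group_add \<Rightarrow> 'b" and f :: "'x \<Rightarrow> 'b"
  assumes t: "vector_space t"
  shows "lin fscale t (lin_ext t f)"
proof (rule linI[OF vs_free t])
  fix u v :: "'x \<Rightarrow>\<^sub>0 'k" and c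
  let ?X = "Poly_Mapping.keys u \<union> Poly_Mapping.keys v"
  have "Poly_Mapping.keys (u + v) \<subseteq> ?X" "Poly_Mapping.keys (fscale c u) \<subseteq> ?X"
    by (rule keys_add) (auto simp: in_keys_iff)
  then show "lin_ext t f (u + v) = lin_ext t f u + lin_ext t f v"
    "lin_ext t f (fscale c u) = t c (lin_ext t f u)"
    by (simp_all add: lin_ext_superset[OF t, of ?X] lookup_add vs_add_left[OF t] sum.distrib vs_assoc[OF t] vs_sum[OF t])
qed

lemma lin_ext_single: "vector_space t \<Longrightarrow> lin_ext t f (Poly_Mapping.single x c) = t c (f x)"
  by (auto simp: lin_ext_def vs_zero)

lemma lin_ext_zero: "lin_ext t f 0 = 0"
  by (simp add: lin_ext_def)

lemma lin_ext_const0: "vector_space t \<Longrightarrow> lin_ext t (\<lambda>x. 0) u = 0"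
  by (simp add: lin_ext_def vs_zero_right)

lemma lin_ext_cong:
  "(\<And>x. x \<in> Poly_Mapping.keys u \<Longrightarrow> f x = g x) \<Longrightarrow> lin_ext t f u = lin_ext t g u"
  by (simp add: lin_ext_def)

lemma lin_ext_plus: "vector_space t \<Longrightarrow> lin_ext t (\<lambda>x. f x + g x) u = lin_ext t f u + lin_ext t g u"
  by (simp add: lin_ext_def vs_add sum.distrib)

lemma lin_ext_minus: "vector_space t \<Longrightarrow> lin_ext t (\<lambda>x. f x - g x) u = lin_ext t f u - lin_ext t g u"
  by (simp add: lin_ext_def vs_diff sum_subtractf)

lemma lin_lin_ext_comp: "lin t r g \<Longrightarrow> g (lin_ext t f u) = lin_ext r (\<lambda>x. g (f x)) u"
  by (simp add: lin_ext_def lin_sum lin_scale)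

lemma lin_lin_ext_fun:
  assumes "vector_space s" "vector_space t" "\<And>x. lin s t (\<lambda>a. F a x)"
  shows "lin s t (\<lambda>a. lin_ext t (F a) u)"
proof (rule linI[OF assms(1,2)])
  fix a b c
  have "F (a + b) = (\<lambda>x. F a x + F b x)" using assms by (auto simp: lin_add[OF assms(3)])
  then show "lin_ext t (F (a + b)) u = lin_ext t (F a) u + lin_ext t (F b) u"
    by (simp add: lin_ext_plus[OF assms(2)])
  have "F (s c a) = (\<lambda>x. t c (F a x))" using assms by (auto simp: lin_scale[OF assms(3)])
  then show "lin_ext t (F (s c a)) u = t c (lin_ext t (F a) u)"
    by (simp add: lin_lin_ext_comp[OF lin_scaled[OF lin_ident[OF assms(2)]]])
qed

lemma lin_ext_swap:
  assumes t: "vector_space t"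
  shows "lin_ext t (\<lambda>x. lin_ext t (F x) v) u = lin_ext t (\<lambda>y. lin_ext t (\<lambda>x. F x y) u) v"
  unfolding lin_ext_def
  by (simp add: vs_sum[OF t] vs_assoc[OF t] sum.swap[of _ "Poly_Mapping.keys u"] mult.commute)

lemma lin_ext_in_subspace:
  assumes "module.subspace t S" "vector_space t" "\<And>x. x \<in> Poly_Mapping.keys u \<Longrightarrow> f x \<in> S"
  shows "lin_ext t f u \<in> S"
proof -
  interpret vector_space t by fact
  show ?thesis unfolding lin_ext_def using assms by (auto intro!: subspace_sum subspace_scale)
qed

lemma poly_mapping_as_lin_ext: "u = lin_ext fscale (\<lambda>x. Poly_Mapping.single x 1) u"
proof (rule poly_mapping_eqI)
  fix k
  show "Poly_Mapping.lookup u k =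
    Poly_Mapping.lookup (lin_ext fscale (\<lambda>x. Poly_Mapping.single x 1) u) k"
    by (simp add: lin_ext_def lookup_sum lookup_single when_def in_keys_iff if_distrib cong: if_cong)
qed

lemma lin_free_eq_lin_ext:
  assumes "lin fscale t g"
  shows "g u = lin_ext t (\<lambda>x. g (Poly_Mapping.single x 1)) u"
  by (subst poly_mapping_as_lin_ext) (rule lin_lin_ext_comp[OF assms])

text \<open>Extend a basis of the span by \<open>x\<close> and prescribe 0 on that basis and 1 at
  \<open>x\<close>. This replaces quotient spaces: non-membership in a space of relations is
  witnessed by a functional.\<close>

lemma separating_functional:
  assumes s: "vector_space s" and x: "x \<notin> module.span s G"
  obtains f where "lin s (*) f" "\<And>y. y \<in> module.span s G \<Longrightarrow> f y = 0" "f x = 1"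
proof -
  interpret V: vector_space s by fact
  interpret VP: vector_space_pair s "(*)" by (intro vector_space_pair.intro s vs_field)
  obtain B where B: "B \<subseteq> V.span G" "V.independent B" "V.span G \<subseteq> V.span B"
    by (rule V.basis_exists[of "V.span G"])
  have span_B: "V.span B = V.span G"
    using V.span_mono[OF B(1)] B(3) by (simp add: V.span_span subset_antisym)
  have "V.independent (insert x B)" using x B(2) unfolding span_B[symmetric] by (rule V.independent_insertI)
  from VP.linear_independent_extend[OF this, of "\<lambda>y. if y = x then 1 else 0"]
  obtain f where f: "lin s (*) f" "\<forall>y\<in>insert x B. f y = (if y = x then 1 else 0)"
    by blast
  have "x \<notin> B" using B(1) x by blast
  with f(2) have "f y = 0" if "y \<in> B" for y using that by auto
  then have "f y = 0" if "y \<in> V.span G" for y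
    using VP.linear_eq_0_on_span[OF f(1), of B y] that span_B by blast
  with f show ?thesis using that by simp
qed

subsection \<open>Bilinear maps and equality of tensors\<close>

definition bil :: "('k::field \<Rightarrow> 'a::ab_group_add \<Rightarrow> 'a) \<Rightarrow> ('k \<Rightarrow> 'w::ab_group_add \<Rightarrow> 'w) \<Rightarrow>
    ('a \<Rightarrow> 'a \<Rightarrow> 'w) \<Rightarrow> bool" where
  "bil s t B \<longleftrightarrow> (\<forall>y. lin s t (\<lambda>x. B x y)) \<and> (\<forall>x. lin s t (B x))"

lemma bilI: "(\<And>y. lin s t (\<lambda>x. B x y)) \<Longrightarrow> (\<And>x. lin s t (\<lambda>y. B x y)) \<Longrightarrow> bil s t B"
  by (simp add: bil_def)

lemma bil_left: "bil s t B \<Longrightarrow> lin r s f \<Longrightarrow> lin r t (\<lambda>x. B (f x) y)"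
  unfolding bil_def using lin_comp by blast

lemma bil_right: "bil s t B \<Longrightarrow> lin r s f \<Longrightarrow> lin r t (\<lambda>x. B y (f x))"
  unfolding bil_def using lin_comp by blast

lemma bil_vs: "bil s t B \<Longrightarrow> vector_space s" "bil s t B \<Longrightarrow> vector_space t"
  unfolding bil_def using lin_vs by blast+

lemma bil_add_left: "bil s t B \<Longrightarrow> B (x + y) z = B x z + B y z"
  and bil_add_right: "bil s t B \<Longrightarrow> B z (x + y) = B z x + B z y"
  and bil_scale_left: "bil s t B \<Longrightarrow> B (s c x) z = t c (B x z)"
  and bil_scale_right: "bil s t B \<Longrightarrow> B z (s c x) = t c (B z x)"
  and bil_diff_left: "bil s t B \<Longrightarrow> B (x - y) z = B x z - B y z"
  and bil_diff_right: "bil s t B \<Longrightarrow> B z (x - y) = B z x - B z y"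
  and bil_zero_left: "bil s t B \<Longrightarrow> B 0 z = 0"
  and bil_zero_right: "bil s t B \<Longrightarrow> B z 0 = 0"
  unfolding bil_def using lin_add lin_scale lin_diff lin_zero by blast+

text \<open>A bilinear map kills the four families of generators of
  \<open>tensor_null\<close>.\<close>

lemma tensor_eq_lin_ext:
  assumes "tensor_eq s u v" and B: "bil s t B"
  shows "lin_ext t (\<lambda>(x, y). B x y) u = lin_ext t (\<lambda>(x, y). B x y) v"
proof -
  note t = bil_vs(2)[OF B]
  note l = lin_lin_ext[OF t, of "\<lambda>(x, y). B x y"]
  interpret VP: vector_space_pair fscale t by (intro vector_space_pair.intro vs_free t)
  have "lin_ext t (\<lambda>(x, y). B x y) (u - v) = 0"
    by (rule VP.linear_eq_0_on_span[OF l _ assms(1)[unfolded tensor_eq_def tensor_null_def]])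
      (auto simp: lin_diff[OF l] lin_scale[OF l] lin_ext_single[OF t] vs_one[OF t]
        bil_add_left[OF B] bil_add_right[OF B] bil_scale_left[OF B] bil_scale_right[OF B])
  then show ?thesis by (simp add: lin_diff[OF l])
qed

text \<open>Scalar bilinear forms separate tensors: a functional that vanishes on the relations but
  not on \<open>u - v\<close> is, on pure tensors, a bilinear form distinguishing \<open>u\<close>
  from \<open>v\<close>. Coproduct identities can therefore be checked on forms
  \<open>\<beta>\<close>.\<close>

lemma tensor_eqI:
  assumes s: "vector_space s"
    and eq: "\<And>\<beta>. bil s (*) \<beta> \<Longrightarrow> lin_ext (*) (\<lambda>(x, y). \<beta> x y) u = lin_ext (*) (\<lambda>(x, y). \<beta> x y) v"
  shows "tensor_eq s u v"
proof (rule ccontr)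
  assume "\<not> tensor_eq s u v"
  then obtain f where f: "lin fscale (*) f" "\<And>y. y \<in> tensor_null s \<Longrightarrow> f y = 0" "f (u - v) = 1"
    unfolding tensor_eq_def tensor_null_def by (rule separating_functional[OF vs_free]) blast
  define \<beta> where "\<beta> x y = f (x \<otimes> y)" for x y
  have "f ((x + y) \<otimes> z - x \<otimes> z - y \<otimes> z) = 0" "f (x \<otimes> (y + z) - x \<otimes> y - x \<otimes> z) = 0"
    "f ((s c x) \<otimes> y - fscale c (x \<otimes> y)) = 0" "f (x \<otimes> (s c y) - fscale c (x \<otimes> y)) = 0" for x y z c
    by (rule f(2), unfold tensor_null_def, rule free.span_base, blast)+
  then have "bil s (*) \<beta>"
    by (auto intro!: bilI linI s vs_field simp: \<beta>_def lin_add[OF f(1)] lin_diff[OF f(1)] lin_scale[OF f(1)] algebra_simps)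
  from eq[OF this] have "f u = f v"
    by (simp add: lin_free_eq_lin_ext[OF f(1), of u] lin_free_eq_lin_ext[OF f(1), of v] \<beta>_def
        case_prod_unfold)
  then show False using f by (simp add: lin_diff)
qed

subsection \<open>Multilinear functions on words\<close>

text \<open>The two clauses mirror the generators of \<open>tensor_alg_null\<close>, for words of
  every length.\<close>

definition multilin :: "('k::field \<Rightarrow> 'v::ab_group_add \<Rightarrow> 'v) \<Rightarrow> ('k \<Rightarrow> 'w::ab_group_add \<Rightarrow> 'w) \<Rightarrow>
    ('v list \<Rightarrow> 'w) \<Rightarrow> bool" where
  "multilin s t f \<longleftrightarrow> (\<forall>p q x y. f (p @ [x + y] @ q) = f (p @ [x] @ q) + f (p @ [y] @ q)) \<and>
     (\<forall>p q c x. f (p @ [s c x] @ q) = t c (f (p @ [x] @ q)))"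

lemma multilin_null:
  assumes t: "vector_space t" and f: "multilin s t f" and u: "u \<in> tensor_alg_null s"
  shows "lin_ext t f u = 0"
proof -
  interpret VP: vector_space_pair fscale t by (intro vector_space_pair.intro vs_free t)
  note l = lin_lin_ext[OF t, of f]
  have *: "f (p @ (x + y) # q) = f (p @ x # q) + f (p @ y # q)"
    "f (p @ s c x # q) = t c (f (p @ x # q))" for p q x y c
    using f by (auto simp: multilin_def)
  show ?thesis
    by (rule VP.linear_eq_0_on_span[OF l _ u[unfolded tensor_alg_null_def]])
      (auto simp: lin_diff[OF l] lin_scale[OF l] lin_ext_single[OF t] vs_one[OF t] *)
qed

subsection \<open>Sweedler sums in a coalgebra\<close>

context coalgebra
begin

text \<open>The Sweedler sum of \<open>B a' a''\<close>. For bilinear \<open>B\<close> it depends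
  only on the class of \<open>\<Delta> a\<close> in the tensor product, so equations between values
  of \<open>sw\<close> replace congruences of formal sums.\<close>

definition sw :: "('k \<Rightarrow> 'w::ab_group_add \<Rightarrow> 'w) \<Rightarrow> ('a \<Rightarrow> 'a \<Rightarrow> 'w) \<Rightarrow> 'a \<Rightarrow> 'w" where
  "sw t B a = lin_ext t (\<lambda>(x, y). B x y) (\<Delta> a)"

lemma vs: "vector_space scale"
  by (rule vector_space_axioms)

lemma lin_sw:
  assumes "bil scale t B"
  shows "lin scale t (sw t B)"
proof -
  note t = bil_vs(2)[OF assms]
  show ?thesis
    using tensor_eq_lin_ext[OF coproduct_add assms] tensor_eq_lin_ext[OF coproduct_scale assms]
    by (intro linI vs t) (simp_all add: sw_def lin_add[OF lin_lin_ext[OF t]] lin_scale[OF lin_lin_ext[OF t]])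
qed

lemma lin_sw_comp: "bil scale t B \<Longrightarrow> lin r scale f \<Longrightarrow> lin r t (\<lambda>x. sw t B (f x))"
  using lin_sw lin_comp by blast

lemma lin_sw_fun:
  assumes "vector_space t" "vector_space r" "\<And>x y. lin r t (\<lambda>b. C b x y)"
  shows "lin r t (\<lambda>b. sw t (\<lambda>x y. C b x y) a)"
  unfolding sw_def using assms by (intro lin_lin_ext_fun) auto

lemma sw_cong: "(\<And>x y. B x y = C x y) \<Longrightarrow> sw t B a = sw t C a"
  by (simp add: sw_def)

lemma sw_plus: "vector_space t \<Longrightarrow> sw t (\<lambda>x y. B x y + C x y) a = sw t B a + sw t C a"
  by (simp add: sw_def case_prod_unfold lin_ext_plus)

lemma sw_minus: "vector_space t \<Longrightarrow> sw t (\<lambda>x y. B x y - C x y) a = sw t B a - sw t C a"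
  by (simp add: sw_def case_prod_unfold lin_ext_minus)

lemma sw_zero: "vector_space t \<Longrightarrow> sw t (\<lambda>x y. 0) a = 0"
  by (simp add: sw_def lin_ext_def vs_zero_right)

lemma lin_of_sw: "lin t r g \<Longrightarrow> g (sw t B a) = sw r (\<lambda>x y. g (B x y)) a"
  by (simp add: sw_def lin_lin_ext_comp case_prod_unfold)

lemma sw_swap:
  assumes "vector_space t"
  shows "sw t (\<lambda>x y. sw t (\<lambda>z w. F x y z w) b) a = sw t (\<lambda>z w. sw t (\<lambda>x y. F x y z w) a) b"
  unfolding sw_def case_prod_unfold by (rule lin_ext_swap[OF assms])

lemma counit_lin: "lin scale (*) \<epsilon>"
  by (rule counit_linear)

lemmas counit_simps = lin_add[OF counit_lin] lin_diff[OF counit_lin] lin_scale[OF counit_lin]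
  lin_zero[OF counit_lin]

lemma sw_counit_left:
  assumes "lin scale t f"
  shows "sw t (\<lambda>x y. t (\<epsilon> x) (f y)) a = f a"
  using lin_lin_ext_comp[OF assms, of "\<lambda>(x, y). scale (\<epsilon> x) y" "\<Delta> a"]
  by (simp add: sw_def case_prod_unfold counit_left[unfolded case_prod_unfold] lin_scale[OF assms])

lemma sw_counit_right:
  assumes "lin scale t f"
  shows "sw t (\<lambda>x y. t (\<epsilon> y) (f x)) a = f a"
  using lin_lin_ext_comp[OF assms, of "\<lambda>(x, y). scale (\<epsilon> y) x" "\<Delta> a"]
  by (simp add: sw_def case_prod_unfold counit_right[unfolded case_prod_unfold] lin_scale[OF assms])

text \<open>The coassociativity axiom lives in \<open>T(A)\<close>, so the trilinear
  \<open>C\<close> is extended by zero to a multilinear function on all words.\<close>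

lemma sw_coassoc:
  assumes C: "\<And>y z. lin scale t (\<lambda>x. C x y z)" "\<And>x z. lin scale t (\<lambda>y. C x y z)"
    "\<And>x y. lin scale t (\<lambda>z. C x y z)"
  shows "sw t (\<lambda>x z. sw t (\<lambda>x' x''. C x' x'' z) x) a = sw t (\<lambda>x y. sw t (\<lambda>y' y''. C x y' y'') y) a"
proof -
  define f where "f w = (if length w = 3 then C (w ! 0) (w ! 1) (w ! 2) else 0)" for w
  have f: "f [x, y, z] = C x y z" for x y z
    by (simp add: f_def numeral_2_eq_2)
  note t = lin_vs(2)[OF C(1)]
  note l = lin_lin_ext[OF t, of f]
  \<comment> \<open>A distinguished slot in a word of three letters is the first, the second or the
    third.\<close>
  have len3: "p = [] \<and> (\<exists>y z. q = [y, z]) \<or> (\<exists>x z. p = [x] \<and> q = [z]) \<or> (\<exists>x y. p = [x, y] \<and> q = [])"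
    if "length (p @ [u] @ q) = 3" for p q :: "'a list" and u
  proof -
    have "length p + length q = 2" using that by simp
    then consider "length p = 0" "length q = 2" | "length p = 1" "length q = 1" | "length p = 2" "length q = 0"
      by linarith
    then show ?thesis by cases (auto simp: length_Suc_conv numeral_2_eq_2)
  qed
  have "multilin scale t f"
    unfolding multilin_def
  proof (intro conjI allI)
    fix p q x y c
    show "f (p @ [x + y] @ q) = f (p @ [x] @ q) + f (p @ [y] @ q)"
      "f (p @ [scale c x] @ q) = t c (f (p @ [x] @ q))"
      using len3[of p x q]
      by (cases "length (p @ [x] @ q) = 3"; auto simp: f f_def lin_add[OF C(1)] lin_add[OF C(2)]
          lin_add[OF C(3)] lin_scale[OF C(1)] lin_scale[OF C(2)] lin_scale[OF C(3)]
          vs_zero_right[OF t] numeral_2_eq_2)+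
  qed
  from multilin_null[OF t this coassoc[unfolded tensor_alg_eq_def, of a]]
  show ?thesis
    by (simp add: sw_def lin_diff[OF l] case_prod_unfold lin_lin_ext_comp[OF l] lin_ext_single[OF t]
        vs_one[OF t] f)
qed

lemma tensor_eq_iff_sw:
  "tensor_eq scale u v \<longleftrightarrow> (\<forall>\<beta>. bil scale (*) \<beta> \<longrightarrow>
     lin_ext (*) (\<lambda>(x, y). \<beta> x y) u = lin_ext (*) (\<lambda>(x, y). \<beta> x y) v)"
  using tensor_eq_lin_ext tensor_eqI[OF vs] by blast

end

section \<open>Coalgebras with a chosen group-like element\<close>

locale pointed_coalgebra = coalgebra scale \<Delta> \<epsilon>
  for scale :: "'k::field \<Rightarrow> 'a::ab_group_add \<Rightarrow> 'a" and \<Delta> \<epsilon> +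
  fixes e :: 'a
  assumes grouplike: "group_like e"
begin

lemma counit_e: "\<epsilon> e = 1"
  using grouplike by (simp add: group_like_def)

lemma sw_e:
  assumes "bil scale t B"
  shows "sw t B e = B e e"
  using tensor_eq_lin_ext[OF _ assms, of "\<Delta> e" "e \<otimes> e"] grouplike bil_vs(2)[OF assms]
  by (simp add: group_like_def sw_def lin_ext_single vs_one)

text \<open>The projection onto \<open>A\<^sub>+\<close> along \<open>K e\<close>.\<close>

definition aug :: "'a \<Rightarrow> 'a" where
  "aug a = a - scale (\<epsilon> a) e"

lemma lin_aug: "lin scale scale aug"
  unfolding aug_def using lin_functional_scaled[OF counit_lin vs] lin_ident[OF vs]
  by (rule lin_minus[rotated])

lemma counit_aug: "\<epsilon> (aug a) = 0"
  by (simp add: aug_def counit_simps counit_e)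

lemma aug_in: "aug a \<in> augmentation_ideal \<epsilon>"
  by (simp add: augmentation_ideal_def counit_aug)

lemma aug_id: "a \<in> augmentation_ideal \<epsilon> \<Longrightarrow> aug a = a"
  by (simp add: augmentation_ideal_def aug_def)

lemma aug_e: "aug e = 0"
  by (simp add: aug_def counit_e)

lemma aug_decomp: "a = aug a + scale (\<epsilon> a) e"
  by (simp add: aug_def)

lemma lin_ext_reduced_coproduct:
  assumes "bil scale t B"
  shows "lin_ext t (\<lambda>(x, y). B x y) (reduced_coproduct \<Delta> e a) = sw t B a - B a e - B e a"
  using bil_vs(2)[OF assms]
  by (simp add: reduced_coproduct_def sw_def lin_diff[OF lin_lin_ext] lin_ext_single vs_one)

lemma primitives_iff:
  "a \<in> primitives scale \<Delta> \<epsilon> e \<longleftrightarrow> \<epsilon> a = 0 \<and> (\<forall>\<beta>. bil scale (*) \<beta> \<longrightarrow> sw (*) \<beta> a = \<beta> a e + \<beta> e a)"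
  by (auto simp: primitives_def augmentation_ideal_def tensor_eq_iff_sw lin_ext_reduced_coproduct
      lin_ext_zero algebra_simps)

lemma counit_primitive: "p \<in> primitives scale \<Delta> \<epsilon> e \<Longrightarrow> \<epsilon> p = 0"
  by (simp add: primitives_iff)

lemma sw_primitive:
  assumes "a \<in> primitives scale \<Delta> \<epsilon> e" "bil scale t B"
  shows "sw t B a = B a e + B e a"
proof -
  have "tensor_eq scale (reduced_coproduct \<Delta> e a) 0"
    using assms by (simp add: primitives_def)
  from tensor_eq_lin_ext[OF this assms(2)] show ?thesis
    by (simp add: lin_ext_reduced_coproduct[OF assms(2)] lin_ext_zero algebra_simps)
qed

lemma subspace_primitives: "module.subspace scale (primitives scale \<Delta> \<epsilon> e)"
  by (auto intro!: subspaceI simp: primitives_iff counit_simps lin_add[OF lin_sw]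
      lin_scale[OF lin_sw] lin_zero[OF lin_sw] bil_add_left bil_add_right bil_scale_left
      bil_scale_right bil_zero_left bil_zero_right algebra_simps)

text \<open>Bridge between \<open>sw\<close> and the representations used in the dendriform axioms:
  the full coproduct adds two boundary terms containing \<open>e\<close>.\<close>

lemma sweedler_rep_lin_ext:
  assumes "sweedler_rep scale \<Delta> \<epsilon> e a u" and B: "bil scale t B"
  shows "sw t B a = lin_ext t (\<lambda>(x, y). B x y) u + B a e + B e a"
  using tensor_eq_lin_ext[OF _ B, of u "reduced_coproduct \<Delta> e a"] assms
  by (simp add: lin_ext_reduced_coproduct[OF B] sweedler_rep_def)

lemma sweedler_rep_keys:
  "sweedler_rep scale \<Delta> \<epsilon> e a u \<Longrightarrow> (x, y) \<in> Poly_Mapping.keys u \<Longrightarrow>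
     x \<in> augmentation_ideal \<epsilon> \<and> y \<in> augmentation_ideal \<epsilon>"
  by (auto simp: sweedler_rep_def)

text \<open>Apply \<open>aug \<otimes> aug\<close> to \<open>\<Delta> a\<close>; the counit axioms
  collapse the correction terms to \<open>a \<otimes> e\<close> and \<open>e \<otimes> a\<close>,
  since \<open>\<epsilon> a = 0\<close>.\<close>

lemma sweedler_rep_exists:
  assumes a: "a \<in> augmentation_ideal \<epsilon>"
  obtains u where "sweedler_rep scale \<Delta> \<epsilon> e a u"
proof -
  define u where "u = lin_ext fscale (\<lambda>(x, y). aug x \<otimes> aug y) (\<Delta> a)"
  have "Poly_Mapping.keys u \<subseteq> augmentation_ideal \<epsilon> \<times> augmentation_ideal \<epsilon>"
  proof
    fix z assume "z \<in> Poly_Mapping.keys u"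
    \<comment> \<open>A key comes from some summand, since otherwise its coefficient would be a sum
      of zeros.\<close>
    then have "\<exists>x\<in>Poly_Mapping.keys (\<Delta> a). z = (aug (fst x), aug (snd x))"
      by (rule_tac ccontr) (auto simp: u_def lin_ext_def in_keys_iff[of _ "sum _ _"] lookup_sum
          case_prod_unfold lookup_single when_def intro!: sum.neutral)
    then show "z \<in> augmentation_ideal \<epsilon> \<times> augmentation_ideal \<epsilon>"
      by (auto simp: aug_in)
  qed
  moreover have "tensor_eq scale u (reduced_coproduct \<Delta> e a)"
  proof (rule tensor_eqI[OF vs])
    fix \<beta> :: "'a \<Rightarrow> 'a \<Rightarrow> 'k" assume \<beta>: "bil scale (*) \<beta>"
    have "lin_ext (*) (\<lambda>(x, y). \<beta> x y) u = sw (*) (\<lambda>x y. \<beta> (aug x) (aug y)) a"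
      by (simp add: u_def sw_def lin_lin_ext_comp[OF lin_lin_ext[OF vs_field]] case_prod_unfold
          lin_ext_single[OF vs_field])
    also have "\<dots> = sw (*) (\<lambda>x y. (\<beta> x y - \<epsilon> y * \<beta> x e) - \<epsilon> x * (\<beta> e y - \<epsilon> y * \<beta> e e)) a"
      by (rule sw_cong)
        (simp add: aug_def bil_diff_left[OF \<beta>] bil_diff_right[OF \<beta>] bil_scale_left[OF \<beta>]
          bil_scale_right[OF \<beta>] algebra_simps)
    also have "\<dots> = sw (*) \<beta> a - \<beta> a e - (\<beta> e a - \<epsilon> a * \<beta> e e)"
    proof -
      have "lin scale (*) (\<lambda>y. \<beta> e y - \<epsilon> y * \<beta> e e)"
        by (intro lin_minus bil_right[OF \<beta>] lin_ident vs lin_functional_scaled counit_lin vs_field)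
      note this[THEN sw_counit_left]
      moreover have "lin scale (*) (\<lambda>x. \<beta> x e)"
        by (intro bil_left[OF \<beta>] lin_ident vs)
      note this[THEN sw_counit_right]
      ultimately show ?thesis by (simp add: sw_minus[OF vs_field])
    qed
    finally show "lin_ext (*) (\<lambda>(x, y). \<beta> x y) u = lin_ext (*) (\<lambda>(x, y). \<beta> x y) (reduced_coproduct \<Delta> e a)"
      using a by (simp add: lin_ext_reduced_coproduct[OF \<beta>] augmentation_ideal_def)
  qed
  ultimately show ?thesis using that by (auto simp: sweedler_rep_def)
qed

end

subsection \<open>Projections onto the primitive elements\<close>

text \<open>\<open>R c v\<close> is the preimage of \<open>c \<otimes> \<pi> v\<close> under (id
  \<otimes> \<pi>) \<circ> \<Delta> on \<open>A\<^sub>+\<close>: the last two assumptions say that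
  the two maps are inverse to each other, and \<open>R_pi\<close> makes \<open>R\<close> total in
  its second argument. The last assumption speaks of scalar forms because a locale assumption has
  fixed types.\<close>

locale splitting = pointed_coalgebra scale \<Delta> \<epsilon> e
  for scale :: "'k::field \<Rightarrow> 'a::ab_group_add \<Rightarrow> 'a" and \<Delta> \<epsilon> e +
  fixes \<pi> :: "'a \<Rightarrow> 'a" and R :: "'a \<Rightarrow> 'a \<Rightarrow> 'a"
  assumes lin_pi: "lin scale scale \<pi>"
    and pi_primitive: "\<pi> a \<in> primitives scale \<Delta> \<epsilon> e"
    and pi_id: "p \<in> primitives scale \<Delta> \<epsilon> e \<Longrightarrow> \<pi> p = p"
    and pi_e: "\<pi> e = 0"
    and bil_R: "bil scale scale R"
    and counit_R: "\<epsilon> (R c v) = 0"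
    and R_pi: "R c (\<pi> v) = R c v"
    and sw_R: "sw scale R a = aug a"
    and sw_pi_R_functional: "bil scale (*) \<beta> \<Longrightarrow> sw (*) (\<lambda>x y. \<beta> x (\<pi> y)) (R c v) = \<beta> c (\<pi> v)"
begin

lemma counit_pi: "\<epsilon> (\<pi> a) = 0"
  using counit_primitive pi_primitive by blast

lemma pi_pi: "\<pi> (\<pi> a) = \<pi> a"
  using pi_id pi_primitive by blast

text \<open>Scalar forms detect equality of tensors, so \<open>sw_pi_R_functional\<close> passes to
  arbitrary target spaces.\<close>

lemma sw_pi_R:
  assumes \<beta>: "bil scale t \<beta>"
  shows "sw t (\<lambda>x y. \<beta> x (\<pi> y)) (R c v) = \<beta> c (\<pi> v)"
proof -
  note t = bil_vs(2)[OF \<beta>]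
  have "tensor_eq scale (lin_ext fscale (\<lambda>(x, y). x \<otimes> \<pi> y) (\<Delta> (R c v))) (c \<otimes> \<pi> v)"
    using sw_pi_R_functional[of _ c v]
    by (auto intro!: tensor_eqI[OF vs] simp: lin_lin_ext_comp[OF lin_lin_ext[OF vs_field]]
        case_prod_unfold lin_ext_single[OF vs_field] sw_def)
  from tensor_eq_lin_ext[OF this \<beta>] show ?thesis
    by (simp add: lin_lin_ext_comp[OF lin_lin_ext[OF t]] case_prod_unfold lin_ext_single[OF t]
        sw_def vs_one[OF t])
qed

lemma R_e_right: "R c e = 0"
  using R_pi[of c e] by (simp add: pi_e bil_zero_right[OF bil_R])

text \<open>The coproduct of the primitive element \<open>\<pi> v\<close> has only two terms, and
  \<open>R (\<pi> v) e = 0\<close>.\<close>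

lemma R_e_left: "R e v = \<pi> v"
proof -
  have "aug (\<pi> v) = R (\<pi> v) e + R e (\<pi> v)"
    using sw_primitive[OF pi_primitive bil_R, of v] by (simp add: sw_R)
  then show ?thesis by (simp add: aug_def counit_pi vs_zero[OF vs] R_e_right R_pi)
qed

text \<open>Apply the counit to the first factor in \<open>sw_pi_R\<close>.\<close>

lemma pi_R: "\<pi> (R c v) = scale (\<epsilon> c) (\<pi> v)"
proof -
  have "bil scale scale (\<lambda>x y. scale (\<epsilon> x) y)"
    by (intro bilI lin_functional_scaled lin_scaled lin_ident vs counit_lin)
  from sw_pi_R[OF this, of c v] show ?thesis by (simp add: sw_counit_left[OF lin_pi])
qed

lemma pi_aug: "\<pi> (aug a) = \<pi> a"
  by (simp add: aug_def lin_diff[OF lin_pi] lin_scale[OF lin_pi] pi_e)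

text \<open>In terms of words: a cut of \<open>c\<close> followed by \<open>v\<close> either keeps
  \<open>v\<close> at the end of the right factor or leaves the right factor empty. The proof
  resolves the right factor by \<open>sw_R\<close>, regroups by coassociativity and evaluates by
  \<open>sw_pi_R\<close>.\<close>

lemma sw_R_coproduct:
  assumes \<beta>: "bil scale t \<beta>"
  shows "sw t \<beta> (R c v) = sw t (\<lambda>x y. \<beta> x (R y v)) c + \<beta> (R c v) e"
proof -
  note t = bil_vs(2)[OF \<beta>]
  have lr: "lin scale t (\<beta> x)" and ll: "lin scale t (\<lambda>y. \<beta> y x)" for x
    using \<beta> by (auto simp: bil_def)
  let ?\<gamma> = "\<lambda>x z. sw t (\<lambda>x' x''. \<beta> x' (R x'' z)) x"
  have \<gamma>: "bil scale t ?\<gamma>"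
    by (intro bilI lin_sw_comp lin_sw_fun bil_left[OF \<beta>] bil_right[OF \<beta>] bil_left[OF bil_R]
        bil_right[OF bil_R] lin_ident vs t)
  have "\<beta> x y = sw t (\<lambda>y' y''. \<beta> x (R y' y'')) y + t (\<epsilon> y) (\<beta> x e)" for x y
  proof -
    have "\<beta> x y = \<beta> x (sw scale R y + scale (\<epsilon> y) e)"
      unfolding sw_R by (simp flip: aug_decomp)
    then show ?thesis by (simp add: bil_add_right[OF \<beta>] bil_scale_right[OF \<beta>] lin_of_sw[OF lr])
  qed
  then have "sw t \<beta> (R c v) =
      sw t (\<lambda>x y. sw t (\<lambda>y' y''. \<beta> x (R y' y'')) y + t (\<epsilon> y) (\<beta> x e)) (R c v)"
    by (intro sw_cong)
  also have "\<dots> = sw t (\<lambda>x y. sw t (\<lambda>y' y''. \<beta> x (R y' y'')) y) (R c v) + \<beta> (R c v) e"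
    by (simp add: sw_plus[OF t] sw_counit_right[OF ll])
  also have "sw t (\<lambda>x y. sw t (\<lambda>y' y''. \<beta> x (R y' y'')) y) (R c v) = sw t ?\<gamma> (R c v)"
    by (rule sw_coassoc[symmetric])
      (intro lin_sw_comp lin_sw_fun bil_left[OF \<beta>] bil_right[OF \<beta>] bil_left[OF bil_R]
        bil_right[OF bil_R] lin_ident vs t)+
  \<comment> \<open>\<open>R\<close> sees its second argument only through \<open>\<pi>\<close>,
    which makes \<open>sw_pi_R\<close> applicable.\<close>
  also have "\<dots> = sw t (\<lambda>x z. ?\<gamma> x (\<pi> z)) (R c v)"
    by (simp add: R_pi)
  also have "\<dots> = ?\<gamma> c (\<pi> v)"
    by (rule sw_pi_R[OF \<gamma>])
  finally show ?thesis by (simp add: R_pi)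
qed

end

text \<open>\<open>R c v\<close> lies in \<open>A\<^sub>+\<close>. Reconstructing it with
  \<open>R'\<close> from (id \<otimes> \<pi>) \<circ> \<Delta>, whose value is
  \<open>c \<otimes> \<pi> v\<close>, gives \<open>R' c v\<close>.\<close>

lemma splitting_unique:
  assumes "splitting scale \<Delta> \<epsilon> e \<pi> R" "splitting scale \<Delta> \<epsilon> e \<pi> R'"
  shows "R = R'"
proof (intro ext)
  fix c v
  interpret A: splitting scale \<Delta> \<epsilon> e \<pi> R by fact
  interpret B: splitting scale \<Delta> \<epsilon> e \<pi> R' by fact
  have "R c v = A.aug (R c v)" by (simp add: A.aug_def A.counit_R)
  also have "\<dots> = A.sw scale (\<lambda>x y. R' x (\<pi> y)) (R c v)" by (simp add: B.sw_R B.R_pi)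
  also have "\<dots> = R' c v" using A.sw_pi_R[OF B.bil_R, of c v] by (simp add: B.R_pi)
  finally show "R c v = R' c v" .
qed

context hopf_algebra
begin

lemma bil_mult: "bil scale scale (\<star>)"
  using mult_bilinear by (auto simp: bilinear_on_def intro!: bilI linI vs)

lemma sw_mult:
  assumes \<beta>: "bil scale t \<beta>"
  shows "sw t \<beta> (a \<star> b) = sw t (\<lambda>a' a''. sw t (\<lambda>b' b''. \<beta> (a' \<star> b') (a'' \<star> b'')) b) a"
  using tensor_eq_lin_ext[OF coproduct_mult \<beta>, of a b] bil_vs(2)[OF \<beta>]
  by (simp add: sw_def lin_lin_ext_comp[OF lin_lin_ext[OF bil_vs(2)[OF \<beta>]]] case_prod_unfold
      lin_ext_single vs_one)

end

sublocale hopf_algebra \<subseteq> pointed_coalgebra scale \<Delta> \<epsilon> e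
  by unfold_locales (simp add: group_like_def coproduct_unit counit_unit)

section \<open>Half-products defined by a splitting of a Hopf algebra\<close>

locale splitting_hopf = splitting scale \<Delta> \<epsilon> e \<pi> R + hopf_algebra scale \<Delta> \<epsilon> e mult
  for scale :: "'k::field \<Rightarrow> 'a::ab_group_add \<Rightarrow> 'a" and \<Delta> \<epsilon> e \<pi> R
    and mult :: "'a \<Rightarrow> 'a \<Rightarrow> 'a" (infixl "\<star>" 75)
begin

text \<open>The rule \<open>R c v \<lhd> b = R (c \<star> b) v\<close>, extended to all
  \<open>a\<close> through \<open>aug a = sw scale R a\<close>. It is total on \<open>A\<close>,
  with \<open>e \<lhd> b = 0\<close> and \<open>a \<lhd> e = aug a\<close>, so that its coproduct
  formula has a single boundary term.\<close>

definition left_half :: "'a \<Rightarrow> 'a \<Rightarrow> 'a" (infixl "\<lhd>" 75) where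
  "a \<lhd> b = sw scale (\<lambda>x y. R (x \<star> b) y) a"

definition right_half :: "'a \<Rightarrow> 'a \<Rightarrow> 'a" (infixl "\<rhd>" 75) where
  "a \<rhd> b = a \<star> b - a \<lhd> b"

lemmas lin_rules = bilI lin_sw_comp lin_sw_fun lin_ident vs vs_field lin_minus
  bil_left[OF bil_R] bil_right[OF bil_R] bil_left[OF bil_mult] bil_right[OF bil_mult]
  lin_comp[OF _ lin_pi]

lemma bil_left_half: "bil scale scale (\<lhd>)"
  unfolding left_half_def by (intro lin_rules)

lemma bil_right_half: "bil scale scale (\<rhd>)"
  unfolding right_half_def by (intro lin_rules bil_left[OF bil_left_half] bil_right[OF bil_left_half])

lemma left_half_R: "R c v \<lhd> b = R (c \<star> b) v"
proof -
  have "bil scale scale (\<lambda>x y. R (x \<star> b) y)" by (intro lin_rules)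
  from sw_pi_R[OF this, of c v] show ?thesis by (simp add: left_half_def R_pi)
qed

lemma R_eq_left_half: "R c v = \<pi> v \<lhd> c"
  using left_half_R[of e v c] by (simp add: R_e_left unit_left)

lemma left_half_e_left: "e \<lhd> b = 0"
proof -
  have "bil scale scale (\<lambda>x y. R (x \<star> b) y)" by (intro lin_rules)
  from sw_e[OF this] show ?thesis by (simp add: left_half_def R_e_right)
qed

lemma left_half_e_right: "a \<lhd> e = aug a"
  by (simp add: left_half_def unit_right sw_R)

lemma counit_left_half: "\<epsilon> (a \<lhd> b) = 0"
  by (simp add: left_half_def lin_of_sw[OF counit_lin] counit_R sw_zero[OF vs_field])

text \<open>On each \<open>R x y\<close> both sides multiply \<open>x\<close> on the right, so
  associativity of \<open>\<star>\<close> suffices.\<close>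

lemma left_half_left_half: "a \<lhd> b \<lhd> c = a \<lhd> (b \<star> c)"
proof -
  have "lin scale scale (\<lambda>x. x \<lhd> c)" by (intro bil_left[OF bil_left_half] lin_rules)
  from lin_of_sw[OF this] show ?thesis
    by (simp add: left_half_def[of a] left_half_R mult_assoc)
qed

lemma pi_left_half: "\<pi> (a \<lhd> b) = scale (\<epsilon> b) (\<pi> a)"
proof -
  have "lin scale scale (\<lambda>y. scale (\<epsilon> b) (\<pi> y))" by (intro lin_scaled lin_pi)
  from sw_counit_left[OF this, of a] show ?thesis
    by (simp add: left_half_def lin_of_sw[OF lin_pi] pi_R counit_mult vs_assoc[OF vs])
qed

text \<open>Apply \<open>sw_R_coproduct\<close> to each \<open>R (x \<star> b) y\<close>, expand the
  coproduct of \<open>x \<star> b\<close> multiplicatively, and regroup by coassociativity so that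
  the \<open>R\<close> terms reassemble into \<open>\<lhd>\<close>.\<close>

lemma sw_left_half:
  assumes \<beta>: "bil scale t \<beta>"
  shows "sw t \<beta> (a \<lhd> b) =
    sw t (\<lambda>a' a''. sw t (\<lambda>b' b''. \<beta> (a' \<star> b') (a'' \<lhd> b'')) b) a + \<beta> (a \<lhd> b) e"
proof -
  note t = bil_vs(2)[OF \<beta>]
  have le: "lin scale t (\<lambda>z. \<beta> z e)" and lr: "lin scale t (\<beta> x)" for x
    using \<beta> by (auto simp: bil_def)
  have b1: "bil scale t (\<lambda>s u. \<beta> s (R u y))" for y
    by (intro lin_rules bil_left[OF \<beta>] bil_right[OF \<beta>] t)
  have "sw t \<beta> (a \<lhd> b) = sw t (\<lambda>x y. sw t \<beta> (R (x \<star> b) y)) a"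
    by (simp add: left_half_def lin_of_sw[OF lin_sw[OF \<beta>]])
  also have "\<dots> = sw t (\<lambda>x y. sw t (\<lambda>s u. \<beta> s (R u y)) (x \<star> b) + \<beta> (R (x \<star> b) y) e) a"
    by (simp add: sw_R_coproduct[OF \<beta>])
  also have "\<dots> = sw t (\<lambda>x y. sw t (\<lambda>s u. \<beta> s (R u y)) (x \<star> b)) a + \<beta> (a \<lhd> b) e"
    by (simp add: sw_plus[OF t] left_half_def lin_of_sw[OF le])
  also have "sw t (\<lambda>x y. sw t (\<lambda>s u. \<beta> s (R u y)) (x \<star> b)) a =
      sw t (\<lambda>x y. sw t (\<lambda>x' x''. sw t (\<lambda>b' b''. \<beta> (x' \<star> b') (R (x'' \<star> b'') y)) b) x) a"
    by (simp add: sw_mult[OF b1])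
  also have "\<dots> = sw t (\<lambda>x y. sw t (\<lambda>y' y''. sw t (\<lambda>b' b''. \<beta> (x \<star> b') (R (y' \<star> b'') y'')) b) y) a"
    by (rule sw_coassoc) (intro lin_rules bil_left[OF \<beta>] bil_right[OF \<beta>] t)+
  also have "\<dots> = sw t (\<lambda>x y. sw t (\<lambda>b' b''. sw t (\<lambda>y' y''. \<beta> (x \<star> b') (R (y' \<star> b'') y'')) y) b) a"
    by (rule sw_cong) (rule sw_swap[OF t])
  also have "\<dots> = sw t (\<lambda>x y. sw t (\<lambda>b' b''. \<beta> (x \<star> b') (y \<lhd> b'')) b) a"
    by (simp add: left_half_def lin_of_sw[OF lr])
  finally show ?thesis .
qed

lemma sw_right_half:
  assumes \<beta>: "bil scale t \<beta>"
  shows "sw t \<beta> (a \<rhd> b) =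
    sw t (\<lambda>a' a''. sw t (\<lambda>b' b''. \<beta> (a' \<star> b') (a'' \<rhd> b'')) b) a - \<beta> (a \<lhd> b) e"
  unfolding right_half_def
  by (simp add: lin_diff[OF lin_sw[OF \<beta>]] sw_mult[OF \<beta>] sw_left_half[OF \<beta>] bil_diff_right[OF \<beta>]
      sw_minus[OF bil_vs(2)[OF \<beta>]])

text \<open>For the harder inclusion, sum \<open>R c v = \<pi> v \<lhd> c\<close> over the coproduct
  of \<open>x\<close>. Replacing \<open>c\<close> by \<open>aug c\<close> costs exactly
  \<open>\<pi> x\<close>, which is zero, and leaves generators of the span.\<close>

lemma kernel_pi_eq_span:
  "{x \<in> augmentation_ideal \<epsilon>. \<pi> x = 0} =
   span {a \<lhd> b | a b. a \<in> augmentation_ideal \<epsilon> \<and> b \<in> augmentation_ideal \<epsilon>}" (is "?K = span ?S")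
proof
  show "span ?S \<subseteq> ?K"
    by (rule span_minimal)
      (auto intro!: subspaceI simp: augmentation_ideal_def counit_left_half pi_left_half counit_simps
        lin_add[OF lin_pi] lin_scale[OF lin_pi] lin_zero[OF lin_pi])
  show "?K \<subseteq> span ?S"
  proof
    fix x assume x: "x \<in> ?K"
    have "R c v = \<pi> v \<lhd> aug c + scale (\<epsilon> c) (\<pi> v)" for c v
      by (simp add: R_eq_left_half aug_def bil_diff_right[OF bil_left_half]
          bil_scale_right[OF bil_left_half] left_half_e_right counit_pi)
    then have "sw scale R x = sw scale (\<lambda>c v. \<pi> v \<lhd> aug c + scale (\<epsilon> c) (\<pi> v)) x"
      by (rule sw_cong)
    then have "aug x = sw scale (\<lambda>c v. \<pi> v \<lhd> aug c + scale (\<epsilon> c) (\<pi> v)) x"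
      by (simp add: sw_R)
    also have "\<dots> = sw scale (\<lambda>c v. \<pi> v \<lhd> aug c) x + \<pi> x"
      by (simp add: sw_plus[OF vs] sw_counit_left[OF lin_pi])
    finally have "x = sw scale (\<lambda>c v. \<pi> v \<lhd> aug c) x"
      using x aug_id by simp
    moreover have "sw scale (\<lambda>c v. \<pi> v \<lhd> aug c) x \<in> span ?S"
      unfolding sw_def
    proof (rule lin_ext_in_subspace[OF subspace_span vs])
      fix z
      have "\<pi> (snd z) \<lhd> aug (fst z) \<in> ?S"
        using counit_pi aug_in by (auto simp: augmentation_ideal_def)
      then show "(case z of (c, v) \<Rightarrow> \<pi> v \<lhd> aug c) \<in> span ?S"
        by (auto intro: span_base simp: case_prod_unfold)
    qed
    ultimately show "x \<in> span ?S" by simp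
  qed
qed

context
  assumes ideal: "\<And>a x. \<epsilon> x = 0 \<Longrightarrow> \<pi> x = 0 \<Longrightarrow> \<pi> (a \<star> x) = 0"
begin

text \<open>\<open>aug b - \<pi> b\<close> lies in the ideal, so \<open>\<pi>\<close> kills its
  product with \<open>a\<close>; the contribution of \<open>\<epsilon> b\<close> cancels by
  \<open>pi_left_half\<close>.\<close>

lemma pi_right_half: "\<pi> (a \<rhd> b) = \<pi> (a \<star> \<pi> b)"
proof -
  have "\<pi> (a \<star> (aug b - \<pi> b)) = 0"
    by (rule ideal) (simp_all add: counit_simps counit_aug counit_pi lin_diff[OF lin_pi] pi_aug pi_pi)
  then show ?thesis
    by (simp add: aug_def bil_diff_right[OF bil_mult] bil_scale_right[OF bil_mult] lin_diff[OF lin_pi]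
        lin_scale[OF lin_pi] unit_right right_half_def pi_left_half)
qed

lemma sw_pi_right_half:
  assumes \<beta>: "bil scale t \<beta>"
  shows "sw t (\<lambda>s u. \<beta> s (\<pi> u)) (a \<rhd> b) =
    sw t (\<lambda>a' a''. sw t (\<lambda>b' b''. \<beta> (a' \<star> b') (\<pi> (a'' \<star> \<pi> b''))) b) a"
proof -
  have "bil scale t (\<lambda>s u. \<beta> s (\<pi> u))"
    by (intro lin_rules bil_left[OF \<beta>] bil_right[OF \<beta>] bil_vs(2)[OF \<beta>])
  from sw_right_half[OF this, of a b] show ?thesis
    by (simp add: pi_e bil_zero_right[OF \<beta>] pi_right_half)
qed

text \<open>\<open>(id \<otimes> \<pi>) \<circ> \<Delta>\<close> is injective on the augmentation ideal, so it suffices to compare its values.\<close>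

lemma right_half_left_half: "a \<rhd> b \<lhd> c = a \<rhd> (b \<lhd> c)"
proof -
  have b1: "bil scale scale (\<lambda>s u. R (s \<star> c) u)" by (intro lin_rules)
  have b2: "bil scale scale (\<lambda>s u. R (a' \<star> s) (\<pi> (a'' \<star> \<pi> u)))" for a' a''
    by (intro lin_rules)
  have "a \<rhd> b \<lhd> c = sw scale (\<lambda>s u. R (s \<star> c) (\<pi> u)) (a \<rhd> b)"
    by (simp add: left_half_def R_pi)
  also have "\<dots> = sw scale (\<lambda>a' a''. sw scale (\<lambda>b' b''. R (a' \<star> b' \<star> c) (\<pi> (a'' \<star> \<pi> b''))) b) a"
    by (rule sw_pi_right_half[OF b1])
  also have "\<dots> = sw scale (\<lambda>a' a''. sw scale (\<lambda>s u. R (a' \<star> s) (\<pi> (a'' \<star> \<pi> u))) (b \<lhd> c)) a"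
  proof (rule sw_cong)
    fix a' a''
    \<comment> \<open>\<open>b \<lhd> c\<close> is the sum of the
      \<open>R (b' \<star> c) b''\<close>, and \<open>sw_pi_R\<close> evaluates the outer sum on
      each of them.\<close>
    have "sw scale (\<lambda>s u. R (a' \<star> s) (\<pi> (a'' \<star> \<pi> u))) (R (x \<star> c) y) =
        R (a' \<star> (x \<star> c)) (\<pi> (a'' \<star> \<pi> y))" for x y
      using sw_pi_R[OF b2, of a' a'' "x \<star> c" y] by (simp add: pi_pi)
    then show "sw scale (\<lambda>b' b''. R (a' \<star> b' \<star> c) (\<pi> (a'' \<star> \<pi> b''))) b =
        sw scale (\<lambda>s u. R (a' \<star> s) (\<pi> (a'' \<star> \<pi> u))) (b \<lhd> c)"
      by (simp add: left_half_def lin_of_sw[OF lin_sw[OF b2]] mult_assoc)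
  qed
  also have "\<dots> = sw scale (\<lambda>s u. R s (\<pi> u)) (a \<rhd> (b \<lhd> c))"
    by (rule sw_pi_right_half[OF bil_R, symmetric])
  \<comment> \<open>This element has counit zero, so summing \<open>R\<close> over its coproduct
    returns it.\<close>
  also have "\<dots> = a \<rhd> (b \<lhd> c)"
    by (simp add: R_pi sw_R aug_def right_half_def counit_simps counit_mult counit_left_half)
  finally show ?thesis .
qed

end

end

subsection \<open>Cofree coalgebras\<close>

locale cofree_coalgebra = coalgebra scale \<Delta> \<epsilon>
  for scale :: "'k::field \<Rightarrow> 'a::ab_group_add \<Rightarrow> 'a" and \<Delta> \<epsilon> +
  fixes vscale :: "'k \<Rightarrow> 'v::ab_group_add \<Rightarrow> 'v" and \<phi> :: "('v list \<Rightarrow>\<^sub>0 'k) \<Rightarrow> 'a"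
  assumes vscale: "vector_space vscale"
    and lin_phi: "lin fscale scale \<phi>"
    and surj_phi: "surj \<phi>"
    and kernel_phi: "{u. \<phi> u = 0} = tensor_alg_null vscale"
    and coproduct_word: "tensor_eq scale (\<Delta> (\<phi> (word w)))
      (\<Sum>i\<le>length w. \<phi> (word (take i w)) \<otimes> \<phi> (word (drop i w)))"
    and counit_word: "\<epsilon> (\<phi> (word w)) = (if w = [] then 1 else 0)"
begin

definition W :: "'v list \<Rightarrow> 'a" where
  "W w = \<phi> (word w)"

lemma counit_W: "\<epsilon> (W w) = (if w = [] then 1 else 0)"
  by (simp add: W_def counit_word)

lemma phi_eq: "\<phi> u = lin_ext scale W u"
  unfolding W_def by (rule lin_free_eq_lin_ext[OF lin_phi])

lemma multilin_W: "multilin vscale scale W"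
proof -
  have "\<phi> (word (p @ [x + y] @ q) - word (p @ [x] @ q) - word (p @ [y] @ q)) = 0"
    "\<phi> (word (p @ [vscale c x] @ q) - fscale c (word (p @ [x] @ q))) = 0" for p q x y c
  proof -
    have "word (p @ [x + y] @ q) - word (p @ [x] @ q) - word (p @ [y] @ q) \<in> tensor_alg_null vscale"
      "word (p @ [vscale c x] @ q) - fscale c (word (p @ [x] @ q)) \<in> tensor_alg_null vscale"
      unfolding tensor_alg_null_def by (rule free.span_base, blast)+
    then show "\<phi> (word (p @ [x + y] @ q) - word (p @ [x] @ q) - word (p @ [y] @ q)) = 0"
      "\<phi> (word (p @ [vscale c x] @ q) - fscale c (word (p @ [x] @ q))) = 0"
      unfolding kernel_phi[symmetric] by blast+
  qed
  then show ?thesis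
    by (simp add: multilin_def W_def lin_add[OF lin_phi] lin_diff[OF lin_phi] lin_scale[OF lin_phi] algebra_simps)
qed

lemma W_add: "W (p @ (x + y) # q) = W (p @ x # q) + W (p @ y # q)"
  and W_scale: "W (p @ vscale c x # q) = scale c (W (p @ x # q))"
  using multilin_W by (auto simp: multilin_def)

lemma lin_W_snoc: "lin vscale scale (\<lambda>x. W (w @ [x]))"
  by (intro linI vscale vs W_add W_scale)

lemma lin_W_single: "lin vscale scale (\<lambda>x. W [x])"
  using lin_W_snoc[of "[]"] by simp

text \<open>The linear map induced by \<open>f\<close> through the universal property of
  \<open>T(V)\<close>. \<open>inv \<phi>\<close> picks an arbitrary preimage, on which the result
  does not depend when \<open>f\<close> is multilinear.\<close>

definition lift :: "('k \<Rightarrow> 'w::ab_group_add \<Rightarrow> 'w) \<Rightarrow> ('v list \<Rightarrow> 'w) \<Rightarrow> 'a \<Rightarrow> 'w" where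
  "lift t f a = lin_ext t f (inv \<phi> a)"

lemma lift_phi:
  assumes t: "vector_space t" and f: "multilin vscale t f"
  shows "lift t f (\<phi> u) = lin_ext t f u"
proof -
  have "\<phi> (inv \<phi> (\<phi> u) - u) = 0"
    by (simp add: lin_diff[OF lin_phi] surj_f_inv_f[OF surj_phi])
  then have "inv \<phi> (\<phi> u) - u \<in> tensor_alg_null vscale"
    using kernel_phi by blast
  from multilin_null[OF t f this] show ?thesis
    by (simp add: lift_def lin_diff[OF lin_lin_ext[OF t]])
qed

lemma lift_W: "vector_space t \<Longrightarrow> multilin vscale t f \<Longrightarrow> lift t f (W w) = f w"
  by (simp add: W_def lift_phi lin_ext_single vs_one)

lemma lin_lift:
  assumes t: "vector_space t" and f: "multilin vscale t f"
  shows "lin scale t (lift t f)"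
proof (rule linI[OF vs t])
  fix a b c
  obtain u v where "a = \<phi> u" "b = \<phi> v" using surj_phi by (metis surj_def)
  then show "lift t f (a + b) = lift t f a + lift t f b" "lift t f (scale c a) = t c (lift t f a)"
    by (simp_all add: lift_phi[OF t f] lin_add[OF lin_lin_ext[OF t]] lin_scale[OF lin_lin_ext[OF t]]
        flip: lin_add[OF lin_phi] lin_scale[OF lin_phi])
qed

lemma lin_eq_on_words:
  assumes f: "lin scale t f" and g: "lin scale t g" and eq: "\<And>w. f (W w) = g (W w)"
  shows "f a = g a"
proof -
  obtain u where "a = \<phi> u" using surj_phi by (metis surj_def)
  then show ?thesis
    by (simp add: phi_eq lin_lin_ext_comp[OF f] lin_lin_ext_comp[OF g] eq)
qed

lemma sw_W:
  assumes B: "bil scale t B"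
  shows "sw t B (W w) = (\<Sum>i\<le>length w. B (W (take i w)) (W (drop i w)))"
proof -
  note t = bil_vs(2)[OF B]
  show ?thesis
    using tensor_eq_lin_ext[OF coproduct_word B, of w]
    by (simp add: sw_def W_def lin_sum[OF lin_lin_ext[OF t]] lin_ext_single[OF t] vs_one[OF t])
qed

text \<open>The component of length one, read as a vector of \<open>V\<close>.\<close>

definition letter :: "'a \<Rightarrow> 'v" where
  "letter = lift vscale (\<lambda>w. if length w = 1 then hd w else 0)"

lemma multilin_letter: "multilin vscale vscale (\<lambda>w. if length w = 1 then hd w else 0)"
  by (auto simp: multilin_def vs_zero_right[OF vscale])

lemma letter_W: "letter (W w) = (if length w = 1 then hd w else 0)"
  unfolding letter_def by (rule lift_W[OF vscale multilin_letter])

lemma lin_letter: "lin scale vscale letter"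
  unfolding letter_def by (rule lin_lift[OF vscale multilin_letter])

definition \<sigma> :: "'a \<Rightarrow> 'a" where
  "\<sigma> a = W [letter a]"

text \<open>This is the \<open>R\<close> of the splitting of \<open>A\<close> by word
  length.\<close>

definition append_letter :: "'a \<Rightarrow> 'a \<Rightarrow> 'a" where
  "append_letter c v = lift scale (\<lambda>w. W (w @ [letter v])) c"

lemma lin_sigma: "lin scale scale \<sigma>"
  unfolding \<sigma>_def by (rule lin_comp[OF lin_letter lin_W_single])

lemma sigma_sigma: "\<sigma> (\<sigma> a) = \<sigma> a"
  by (simp add: \<sigma>_def letter_W)

lemma sigma_W: "length w \<noteq> 1 \<Longrightarrow> \<sigma> (W w) = 0"
  by (simp add: \<sigma>_def letter_W lin_zero[OF lin_W_single])

lemma multilin_append: "multilin vscale scale (\<lambda>w. W (w @ [x]))"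
  by (auto simp: multilin_def W_add W_scale)

lemma append_letter_W: "append_letter (W w) v = W (w @ [letter v])"
  by (simp add: append_letter_def lift_W[OF vs multilin_append])

lemma lin_append_letter: "lin scale scale (\<lambda>c. append_letter c v)"
  unfolding append_letter_def by (rule lin_lift[OF vs multilin_append])

lemma bil_append_letter: "bil scale scale append_letter"
  unfolding bil_def append_letter_def lift_def
  using lin_append_letter[unfolded append_letter_def lift_def]
  by (auto intro!: lin_lin_ext_fun vs lin_comp[OF lin_letter lin_W_snoc])

lemma append_letter_sigma: "append_letter c (\<sigma> v) = append_letter c v"
  by (simp add: append_letter_def \<sigma>_def letter_W)

lemma grouplike_empty_word: "pointed_coalgebra scale \<Delta> \<epsilon> (W [])"
  by unfold_locales (use coproduct_word[of "[]"] counit_word[of "[]"] in \<open>simp add: group_like_def W_def\<close>)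

lemma sigma_empty: "\<sigma> (W []) = 0"
  by (simp add: sigma_W)

text \<open>A nonempty word has exactly one cut whose right factor is a single letter. Evaluated on
  words, both inverse properties of a splitting follow from this.\<close>

lemma splitting_sigma: "splitting scale \<Delta> \<epsilon> (W []) \<sigma> append_letter"
proof -
  interpret P: pointed_coalgebra scale \<Delta> \<epsilon> "W []" by (rule grouplike_empty_word)
  have zero: "append_letter c (W []) = 0" for c
    using append_letter_sigma[of c "W []"] by (simp add: sigma_empty bil_zero_right[OF bil_append_letter])
  have eps: "\<epsilon> (append_letter c v) = 0" for c v
    by (rule lin_eq_on_words[where g = "\<lambda>c. 0", OF lin_comp[OF lin_append_letter counit_lin]])
      (simp_all add: lin_const0 vs vs_field append_letter_W counit_W)
  have prim: "\<sigma> a \<in> primitives scale \<Delta> \<epsilon> (W [])" for a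
    by (simp add: P.primitives_iff \<sigma>_def sw_W counit_W)
  have "sw scale append_letter a = P.aug a" for a
  proof (rule lin_eq_on_words[OF lin_sw[OF bil_append_letter] P.lin_aug])
    fix w :: "'v list"
    show "sw scale append_letter (W w) = P.aug (W w)"
    proof (cases w rule: rev_cases)
      case Nil
      then show ?thesis by (simp add: sw_W bil_append_letter zero P.aug_e)
    next
      case (snoc w0 x)
      \<comment> \<open>\<open>i = length w0\<close> is the cut before the last letter.\<close>
      have "append_letter (W (take i w)) (W (drop i w)) = (if i = length w0 then W w else 0)"
        if "i \<le> length w" for i
      proof (cases "i = length w0")
        case True
        then show ?thesis by (simp add: snoc append_letter_W letter_W)
      next
        case False
        then have "\<sigma> (W (drop i w)) = 0" using that by (intro sigma_W) (simp add: snoc)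
        then show ?thesis
          using append_letter_sigma[of "W (take i w)" "W (drop i w)"] False
          by (simp add: bil_zero_right[OF bil_append_letter])
      qed
      then have "sw scale append_letter (W w) = W w"
        by (simp add: sw_W bil_append_letter snoc)
      then show ?thesis by (simp add: P.aug_def counit_W vs_zero[OF vs] snoc)
    qed
  qed
  note sw = this
  \<comment> \<open>For primitive \<open>p\<close> the sum in \<open>sw\<close> reduces to
    \<open>append_letter (W []) p\<close>, which is \<open>\<sigma> p\<close>, while
    \<open>sw\<close> evaluates it to \<open>p\<close>.\<close>
  have sigma_id: "\<sigma> p = p" if p: "p \<in> primitives scale \<Delta> \<epsilon> (W [])" for p
    using P.sw_primitive[OF p bil_append_letter] append_letter_W[of "[]" p] P.counit_primitive[OF p]
    by (simp add: sw zero P.aug_def vs_zero[OF vs] \<sigma>_def)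
  have sw_append: "sw (*) (\<lambda>x y. \<beta> x (\<sigma> y)) (append_letter c v) = \<beta> c (\<sigma> v)"
    if \<beta>: "bil scale (*) \<beta>" for \<beta> :: "'a \<Rightarrow> 'a \<Rightarrow> 'k" and c v
  proof (rule lin_eq_on_words[where f = "\<lambda>c. sw (*) (\<lambda>x y. \<beta> x (\<sigma> y)) (append_letter c v)"])
    have b: "bil scale (*) (\<lambda>x y. \<beta> x (\<sigma> y))"
      by (intro bilI bil_left[OF \<beta>] bil_right[OF \<beta>] lin_sigma lin_ident vs)
    then show "lin scale (*) (\<lambda>c. sw (*) (\<lambda>x y. \<beta> x (\<sigma> y)) (append_letter c v))"
      by (intro lin_sw_comp lin_append_letter)
    show "lin scale (*) (\<lambda>c. \<beta> c (\<sigma> v))"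
      by (intro bil_left[OF \<beta>] lin_ident vs)
    fix w
    have "\<beta> (W (take i (w @ [letter v]))) (\<sigma> (W (drop i (w @ [letter v])))) =
        (if i = length w then \<beta> (W w) (\<sigma> v) else 0)" if "i \<le> Suc (length w)" for i
    proof (cases "i = length w")
      case True
      then show ?thesis by (simp add: \<sigma>_def letter_W)
    next
      case False
      then show ?thesis using that by (simp add: sigma_W bil_zero_right[OF \<beta>])
    qed
    then show "sw (*) (\<lambda>x y. \<beta> x (\<sigma> y)) (append_letter (W w) v) = \<beta> (W w) (\<sigma> v)"
      by (simp add: append_letter_W sw_W[OF b])
  qed
  show ?thesis
    by (intro splitting.intro P.pointed_coalgebra_axioms splitting_axioms.intro)
      (fact lin_sigma prim sigma_id sigma_empty bil_append_letter eps append_letter_sigma sw sw_append)+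
qed

text \<open>
  If \<open>g\<close> had a nonzero letter, the convolution powers of a functional that is \<open>1\<close> on \<open>g\<close> and
  vanishes on all words of length other than one would be \<open>1\<close> on \<open>g\<close>, although every element is
  killed by almost all of these powers.
\<close>

lemma grouplike_unique:
  assumes "pointed_coalgebra scale \<Delta> \<epsilon> g"
  shows "g = W []"
proof -
  interpret P: pointed_coalgebra scale \<Delta> \<epsilon> g by fact
  interpret S: splitting scale \<Delta> \<epsilon> "W []" \<sigma> append_letter by (rule splitting_sigma)
  have "\<sigma> g = 0"
  proof (rule ccontr)
    assume "\<sigma> g \<noteq> 0"
    then have "\<sigma> g \<notin> span {}" by simp
    then obtain f where f: "lin scale (*) f" "f (\<sigma> g) = 1"
      by (rule separating_functional[OF vs])
    define h where "h a = f (\<sigma> a)" for a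
    have h: "lin scale (*) h" unfolding h_def by (rule lin_comp[OF lin_sigma f(1)])
    \<comment> \<open>\<open>pow n\<close> is the convolution power of exponent
      \<open>n + 1\<close>, hence concentrated on words of length \<open>Suc n\<close>.\<close>
    define pow where "pow = rec_nat h (\<lambda>n q. sw (*) (\<lambda>x y. q x * h y))"
    have pow_0: "pow 0 = h" and pow_Suc: "pow (Suc n) = sw (*) (\<lambda>x y. pow n x * h y)" for n
      by (simp_all add: pow_def)
    have bil_prod: "bil scale (*) (\<lambda>x y. q x * h y)" if "lin scale (*) q" for q
      by (intro bilI lin_functional_scaled lin_scaled that h vs_field)
    have lin_pow: "lin scale (*) (pow n)" for n
      by (induction n) (simp_all add: pow_0 pow_Suc h lin_sw bil_prod)
    have "h g = 1" by (simp add: h_def f)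
    then have one: "pow n g = 1" for n
      by (induction n) (simp_all add: pow_0 pow_Suc P.sw_e[OF bil_prod[OF lin_pow]])
    have vanish: "pow n (W w) = 0" if "length w \<noteq> Suc n" for n w
      using that
    proof (induction n arbitrary: w)
      case 0
      then show ?case by (simp add: pow_0 h_def sigma_W lin_zero[OF f(1)])
    next
      case (Suc n)
      have "pow n (W (take i w)) * h (W (drop i w)) = 0" if "i \<le> length w" for i
      proof (cases "length (drop i w) = 1")
        case True
        then have "length (take i w) \<noteq> Suc n" using Suc.prems that by simp
        then show ?thesis by (simp add: Suc.IH)
      next
        case False
        then show ?thesis by (simp add: h_def sigma_W lin_zero[OF f(1)])
      qed
      then show ?case
        unfolding pow_Suc sw_W[OF bil_prod[OF lin_pow]] by (intro sum.neutral) blast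
    qed
    obtain u where u: "g = \<phi> u" using surj_phi by (metis surj_def)
    \<comment> \<open>A bound for all word lengths in \<open>u\<close>; \<open>pow n\<close> is
      nonzero only on longer words.\<close>
    define n where "n = (\<Sum>w\<in>Poly_Mapping.keys u. length w)"
    have "pow n (W w) = 0" if "w \<in> Poly_Mapping.keys u" for w
    proof -
      have "length w \<le> n" unfolding n_def using that by (intro member_le_sum) auto
      then show ?thesis by (intro vanish) simp
    qed
    then have "lin_ext (*) (\<lambda>w. pow n (W w)) u = 0"
      unfolding lin_ext_def by (intro sum.neutral) simp
    then have "pow n (\<phi> u) = 0"
      using lin_lin_ext_comp[OF lin_pow, of n W u] phi_eq[of u] by simp
    with one[of n] u show False by simp
  qed
  \<comment> \<open>Summing \<open>append_letter\<close> over the coproduct of \<open>g\<close>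
    gives this zero, but also \<open>S.aug g\<close>. So \<open>g\<close> is a multiple of
    \<open>W []\<close>, and the counit fixes the scalar.\<close>
  then have "append_letter g g = 0"
    using append_letter_sigma[of g g] by (simp add: bil_zero_right[OF bil_append_letter])
  then have "S.aug g = 0" using P.sw_e[OF bil_append_letter] S.sw_R[of g] by simp
  then show ?thesis by (simp add: S.aug_def P.counit_e)
qed

subsection \<open>Triangular systems\<close>

context
  fixes N :: "'a \<Rightarrow> 'a \<Rightarrow> 'a"
  assumes bil_N: "bil scale scale N"
    and N_empty: "N (W []) v = \<sigma> v"
    and N_sigma: "N c (\<sigma> v) = N c v"
begin

text \<open>On a word \<open>w\<close>, the cut with empty right factor contributes
  \<open>G (W w) v\<close>, because \<open>N (W []) v = \<sigma> v\<close>. All other cuts involve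
  proper prefixes of \<open>w\<close> and vanish by induction on length.\<close>

lemma triangular_unique:
  assumes G: "bil scale t G" and G_sigma: "\<And>c v. G c (\<sigma> v) = G c v"
    and eq: "\<And>c v. sw t (\<lambda>x y. G x (N y v)) c = 0"
  shows "G c v = 0"
proof (rule lin_eq_on_words[where g = "\<lambda>c. 0" and f = "\<lambda>c. G c v"])
  show "lin scale t (\<lambda>c. G c v)" "lin scale t (\<lambda>c. 0)"
    using G bil_vs[OF G] by (auto simp: bil_def intro: lin_const0)
  have b: "bil scale t (\<lambda>x y. G x (N y v))" for v
    by (intro bilI bil_left[OF G] bil_right[OF G] bil_left[OF bil_N] lin_ident vs)
  fix w
  show "G (W w) v = 0"
  proof (induction w arbitrary: v rule: measure_induct_rule[of length])
    case (less w)
    have "(\<Sum>i<length w. G (W (take i w)) (N (W (drop i w)) v)) = 0"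
      by (rule sum.neutral) (simp add: less)
    moreover have "{..length w} = insert (length w) {..<length w}" by auto
    ultimately show ?case
      using eq[of v "W w"] by (simp add: sw_W[OF b] N_empty G_sigma)
  qed
qed

context
  fixes F :: "'a \<Rightarrow> 'a \<Rightarrow> 'a"
  assumes bil_F: "bil scale scale F"
    and F_sigma: "F c (\<sigma> v) = F c v"
begin

text \<open>Forward substitution in the unitriangular system with right-hand side \<open>F\<close>:
  the term of the empty right factor is isolated, those of proper prefixes are subtracted.\<close>

function word_solution :: "'v list \<Rightarrow> 'a \<Rightarrow> 'a" where
  "word_solution w v = F (W w) v - (\<Sum>i\<in>{..<length w}. word_solution (take i w) (N (W (drop i w)) v))"
  by auto
termination by (relation "measure (\<lambda>(w, v). length w)") auto

declare word_solution.simps [simp del]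

lemma lin_word_solution: "lin scale scale (word_solution w)"
proof (induction w rule: measure_induct_rule[of length])
  case (less w)
  have "lin scale scale (\<lambda>v. \<Sum>i\<in>{..<length w}. word_solution (take i w) (N (W (drop i w)) v))"
  proof -
    have *: "lin scale scale (\<lambda>v. word_solution (take i w) (N (W (drop i w)) v))" if "i < length w" for i
      using that by (intro lin_comp[OF _ less] bil_right[OF bil_N] lin_ident vs) auto
    show ?thesis
      by (intro linI vs) (simp_all add: lin_add[OF *] lin_scale[OF *] sum.distrib vs_sum[OF vs])
  qed
  then have "lin scale scale (\<lambda>v. F (W w) v -
      (\<Sum>i\<in>{..<length w}. word_solution (take i w) (N (W (drop i w)) v)))"
    by (intro lin_minus bil_right[OF bil_F] lin_ident vs)
  then show ?case by (subst word_solution.simps[abs_def])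
qed

lemma word_solution_sigma: "word_solution w (\<sigma> v) = word_solution w v"
  by (subst (1 2) word_solution.simps) (simp add: F_sigma N_sigma)

text \<open>The recursion has to respect the relations of \<open>T(V)\<close> in order to define a
  map on \<open>A\<close>. The induction is on the part \<open>q\<close> of the word after the
  changed letter.\<close>

lemma multilin_word_solution: "multilin vscale scale (\<lambda>w. word_solution w v)"
proof -
  have "word_solution (p @ (x + y) # q) v = word_solution (p @ x # q) v + word_solution (p @ y # q) v
     \<and> word_solution (p @ vscale c x # q) v = scale c (word_solution (p @ x # q) v)" for p q x y c
  proof (induction q arbitrary: v rule: measure_induct_rule[of length])
    case (less q)
    let ?T = "\<lambda>x i. word_solution (take i (p @ x # q)) (N (W (drop i (p @ x # q))) v)"
    \<comment> \<open>A cut before the changed letter leaves it in the suffix, where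
      \<open>W\<close> and \<open>N\<close> are linear; a later cut leaves it in a prefix with
      shorter \<open>q\<close>.\<close>
    have T: "?T (x + y) i = ?T x i + ?T y i \<and> ?T (vscale c x) i = scale c (?T x i)"
      if "i < length (p @ x # q)" for i
    proof (cases "i \<le> length p")
      case True
      then show ?thesis
        by (simp add: W_add W_scale bil_add_left[OF bil_N] bil_scale_left[OF bil_N]
            lin_add[OF lin_word_solution] lin_scale[OF lin_word_solution])
    next
      case False
      then obtain j where j: "i = length p + Suc j" by (metis add_Suc_right less_iff_Suc_add not_le)
      then have "length (take j q) < length q" using that by simp
      from less[OF this] show ?thesis by (simp add: j)
    qed
    have ws: "word_solution (p @ z # q) v =
        F (W (p @ z # q)) v - (\<Sum>i\<in>{..<length (p @ x # q)}. ?T z i)" for z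
      by (subst word_solution.simps) simp
    have "(\<Sum>i\<in>{..<length (p @ x # q)}. ?T (x + y) i) =
        (\<Sum>i\<in>{..<length (p @ x # q)}. ?T x i) + (\<Sum>i\<in>{..<length (p @ x # q)}. ?T y i)"
      "(\<Sum>i\<in>{..<length (p @ x # q)}. ?T (vscale c x) i) =
        scale c (\<Sum>i\<in>{..<length (p @ x # q)}. ?T x i)"
      unfolding vs_sum[OF vs] sum.distrib[symmetric] using T by (intro sum.cong; simp)+
    then show ?case
      by (simp only: ws W_add W_scale bil_add_left[OF bil_F] bil_scale_left[OF bil_F])
        (simp add: vs_diff[OF vs])
  qed
  then show ?thesis by (simp add: multilin_def)
qed

lemma triangular_exists:
  "\<exists>E. bil scale scale E \<and> (\<forall>c v. sw scale (\<lambda>x y. E x (N y v)) c = F c v) \<and>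
     (\<forall>c v. E c (\<sigma> v) = E c v)"
proof (intro exI conjI allI)
  let ?E = "\<lambda>c v. lift scale (\<lambda>w. word_solution w v) c"
  have E_W: "?E (W w) v = word_solution w v" for w v
    by (rule lift_W[OF vs multilin_word_solution])
  show bil_E: "bil scale scale ?E"
  proof (rule bilI)
    show "lin scale scale (\<lambda>c. ?E c v)" for v
      by (rule lin_lift[OF vs multilin_word_solution])
    show "lin scale scale (\<lambda>v. ?E c v)" for c
      unfolding lift_def by (intro lin_lin_ext_fun vs lin_word_solution)
  qed
  show "?E c (\<sigma> v) = ?E c v" for c v
    by (simp add: lift_def word_solution_sigma)
  have b: "bil scale scale (\<lambda>x y. ?E x (N y v))" for v
    by (intro bilI bil_left[OF bil_E] bil_right[OF bil_E] bil_left[OF bil_N] lin_ident vs)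
  fix c v
  show "sw scale (\<lambda>x y. ?E x (N y v)) c = F c v"
  proof (rule lin_eq_on_words[OF lin_sw[OF b]])
    show "lin scale scale (\<lambda>c. F c v)" using bil_F by (simp add: bil_def)
    fix w :: "'v list"
    have "{..length w} = insert (length w) {..<length w}" for w :: "'v list" by auto
    then show "sw scale (\<lambda>x y. ?E x (N y v)) (W w) = F (W w) v"
      by (simp add: sw_W[OF b] E_W N_empty word_solution_sigma)
        (subst word_solution.simps, simp)
  qed
qed

end

end

end

subsection \<open>Existence of splittings\<close>

locale pointed_cofree_coalgebra = cofree_coalgebra scale \<Delta> \<epsilon> vscale \<phi> + pointed_coalgebra scale \<Delta> \<epsilon> e
  for scale :: "'k::field \<Rightarrow> 'a::ab_group_add \<Rightarrow> 'a" and \<Delta> \<epsilon>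
    and vscale :: "'k \<Rightarrow> 'v::ab_group_add \<Rightarrow> 'v" and \<phi> e
begin

lemma e_eq: "e = W []"
  by (rule grouplike_unique) (rule pointed_coalgebra_axioms)

sublocale base: splitting scale \<Delta> \<epsilon> e \<sigma> append_letter
  using splitting_sigma by (simp add: e_eq)

text \<open>By the coproduct of \<open>append_letter\<close>, the map (id \<otimes> \<pi>) \<circ>
  \<Delta> sends \<open>append_letter c v\<close> to the sum of the
  \<open>c' \<otimes> N c'' v\<close>, with \<open>N\<close> as below. This system is unitriangular
  in word length and can be inverted.\<close>

lemma splitting_of_projection:
  assumes lin_\<pi>: "lin scale scale \<pi>"
    and prim: "\<And>a. \<pi> a \<in> primitives scale \<Delta> \<epsilon> e"
    and id: "\<And>p. p \<in> primitives scale \<Delta> \<epsilon> e \<Longrightarrow> \<pi> p = p"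
    and \<pi>_e: "\<pi> e = 0"
  obtains R where "splitting scale \<Delta> \<epsilon> e \<pi> R"
proof -
  define N where "N c v = \<pi> (append_letter c v)" for c v
  have N: "bil scale scale N" "N (W []) v = \<sigma> v" "N c (\<sigma> v) = N c v" for c v
    unfolding N_def
    by (intro bilI lin_comp[OF _ lin_\<pi>] bil_left[OF bil_append_letter] bil_right[OF bil_append_letter]
        lin_ident vs)
      (simp_all add: append_letter_sigma base.R_e_left[unfolded e_eq] id base.pi_primitive)
  \<comment> \<open>\<open>E\<close> inverts that triangular map and then applies
    \<open>append_letter\<close>.\<close>
  obtain E where E: "bil scale scale E"
    and E_N: "\<And>c v. sw scale (\<lambda>x y. E x (N y v)) c = append_letter c v"
    and E_sigma: "\<And>c v. E c (\<sigma> v) = E c v"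
    using triangular_exists[OF N bil_append_letter append_letter_sigma] by blast
  define R where "R c v = E c (\<pi> v)" for c v
  have \<pi>_\<pi>: "\<pi> (\<pi> v) = \<pi> v" and \<sigma>_\<pi>: "\<sigma> (\<pi> v) = \<pi> v"
    and \<sigma>_N: "\<sigma> (N c v) = N c v" for c v
    by (simp_all add: N_def id prim base.pi_id)
  have R: "bil scale scale R"
    unfolding R_def by (intro bilI bil_left[OF E] bil_right[OF E] lin_\<pi> lin_ident vs)
  \<comment> \<open>The counit of \<open>E\<close> solves a system whose right-hand side is the
    counit of \<open>append_letter\<close>, which is zero.\<close>
  have "\<epsilon> (E c v) = 0" for c v
  proof (rule triangular_unique[OF N, where G = "\<lambda>c v. \<epsilon> (E c v)" and t = "(*)"])
    show "bil scale (*) (\<lambda>c v. \<epsilon> (E c v))"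
      by (intro bilI lin_comp[OF _ counit_lin] bil_left[OF E] bil_right[OF E] lin_ident vs)
    show "sw (*) (\<lambda>x y. \<epsilon> (E x (N y v))) c = 0" for c v
      by (simp add: E_N base.counit_R flip: lin_of_sw[OF counit_lin])
  qed (simp add: E_sigma)
  then have counit: "\<epsilon> (R c v) = 0" for c v by (simp add: R_def)
  have R_e: "R c e = 0" for c
    by (simp add: R_def \<pi>_e bil_zero_right[OF E])
  have R_app: "sw scale R (append_letter c v) = append_letter c v" for c v
  proof -
    have "sw scale R (append_letter c v) = sw scale (\<lambda>x y. E x (N y v)) c"
      by (simp add: base.sw_R_coproduct[OF R] R_e) (simp add: R_def N_def)
    then show ?thesis by (simp add: E_N)
  qed
  \<comment> \<open>Every \<open>aug a\<close> is a sum of values of \<open>append_letter\<close>,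
    to which \<open>R_app\<close> applies.\<close>
  have sw_R: "sw scale R a = aug a" for a
  proof -
    have "sw scale R a = sw scale R (aug a) + scale (\<epsilon> a) (sw scale R e)"
      using aug_decomp[of a] lin_add[OF lin_sw[OF R]] lin_scale[OF lin_sw[OF R]] by metis
    also have "sw scale R e = 0" by (simp add: sw_e[OF R] R_e)
    also have "sw scale R (aug a) = aug a"
      by (simp add: lin_of_sw[OF lin_sw[OF R]] R_app flip: base.sw_R)
    finally show ?thesis by (simp add: vs_zero_right[OF vs])
  qed
  have sw_\<pi>: "sw (*) (\<lambda>x y. \<beta> x (\<pi> y)) (R c v) = \<beta> c (\<pi> v)"
    if \<beta>: "bil scale (*) \<beta>" for \<beta> :: "'a \<Rightarrow> 'a \<Rightarrow> 'k" and c v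
  proof -
    have b: "bil scale (*) (\<lambda>x y. \<beta> x (\<pi> y))"
      by (intro bilI bil_left[OF \<beta>] bil_right[OF \<beta>] lin_\<pi> lin_ident vs)
    \<comment> \<open>Both terms solve the same triangular system, since the values of
      \<open>N\<close> are primitive and hence fixed by \<open>\<sigma>\<close>.\<close>
    have "sw (*) (\<lambda>x y. \<beta> x (\<pi> y)) (E c w) - \<beta> c (\<sigma> w) = 0" for w
    proof (rule triangular_unique[OF N, where t = "(*)" and
          G = "\<lambda>c w. sw (*) (\<lambda>x y. \<beta> x (\<pi> y)) (E c w) - \<beta> c (\<sigma> w)"])
      show "bil scale (*) (\<lambda>c w. sw (*) (\<lambda>x y. \<beta> x (\<pi> y)) (E c w) - \<beta> c (\<sigma> w))"
        by (intro bilI lin_minus lin_sw_comp[OF b] bil_left[OF \<beta>] bil_right[OF \<beta>] bil_left[OF E]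
            bil_right[OF E] lin_sigma lin_ident vs)
      show "sw (*) (\<lambda>x y. sw (*) (\<lambda>x y. \<beta> x (\<pi> y)) (E x (N y v)) - \<beta> x (\<sigma> (N y v))) c = 0" for c v
        by (simp add: sw_minus[OF vs_field] E_N \<sigma>_N base.sw_R_coproduct[OF b] \<pi>_e
            bil_zero_right[OF \<beta>] flip: lin_of_sw[OF lin_sw[OF b]]) (simp add: N_def)
    qed (simp add: E_sigma sigma_sigma)
    then show ?thesis by (simp add: R_def \<sigma>_\<pi>)
  qed
  have "splitting scale \<Delta> \<epsilon> e \<pi> R"
    by unfold_locales
      (simp_all add: lin_add[OF lin_\<pi>] lin_scale[OF lin_\<pi>] prim id \<pi>_e R counit sw_R sw_\<pi>,
        simp add: R_def \<pi>_\<pi>)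
  then show ?thesis by (rule that)
qed

text \<open>\<open>S c v\<close> is modelled on \<open>\<sigma> v \<lhd> c\<close>. A family with
  the coproduct of \<open>sw_R_coproduct\<close> comes from a splitting, namely for the projection
  that kills \<open>S c v\<close> whenever \<open>\<epsilon> c = 0\<close>.\<close>

lemma splitting_of_coproduct:
  assumes S: "bil scale scale S"
    and S_sigma: "\<And>c v. S c (\<sigma> v) = S c v"
    and S_e: "\<And>v. S e v = \<sigma> v"
    and counit_S: "\<And>c v. \<epsilon> (S c v) = 0"
    and coproduct: "\<And>\<beta> c v. bil scale scale \<beta> \<Longrightarrow>
      sw scale \<beta> (S c v) = sw scale (\<lambda>x y. \<beta> x (S y v)) c + \<beta> (S c v) e"
  obtains \<pi> R where "splitting scale \<Delta> \<epsilon> e \<pi> R" "\<And>c v. R c v = S c (\<pi> v)"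
proof -
  define N where "N c v = \<sigma> (S c v)" for c v
  have N: "bil scale scale N" "N (W []) v = \<sigma> v" "N c (\<sigma> v) = N c v" for c v
    unfolding N_def
    by (intro bilI lin_comp[OF _ lin_sigma] bil_left[OF S] bil_right[OF S] lin_ident vs)
      (simp_all add: S_sigma S_e[unfolded e_eq] sigma_sigma)
  have F: "bil scale scale (\<lambda>c v. scale (\<epsilon> c) (\<sigma> v))"
    by (intro bilI lin_functional_scaled lin_scaled lin_sigma counit_lin vs)
  \<comment> \<open>\<open>E\<close> is chosen so that \<open>\<pi>\<close> below sends
    \<open>S c v\<close> to \<open>scale (\<epsilon> c) (\<sigma> v)\<close>; the outer
    \<open>\<sigma>\<close> in \<open>\<pi>\<close> makes its values primitive.\<close>
  obtain E where E: "bil scale scale E"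
    and E_N: "\<And>c v. sw scale (\<lambda>x y. E x (N y v)) c = scale (\<epsilon> c) (\<sigma> v)"
    using triangular_exists[OF N F] by (auto simp: sigma_sigma)
  have b: "bil scale scale (\<lambda>x y. E x (\<sigma> y))"
    by (intro bilI bil_left[OF E] bil_right[OF E] lin_sigma lin_ident vs)
  define \<pi> where "\<pi> a = \<sigma> (sw scale (\<lambda>x y. E x (\<sigma> y)) a)" for a
  have \<pi>_S: "\<pi> (S c v) = scale (\<epsilon> c) (\<sigma> v)" for c v
    by (simp add: \<pi>_def coproduct[OF b] base.pi_e bil_zero_right[OF E] E_N[unfolded N_def]
        lin_scale[OF lin_sigma] sigma_sigma)
  have lin_\<pi>: "lin scale scale \<pi>"
    unfolding \<pi>_def by (rule lin_comp[OF lin_sw[OF b] lin_sigma])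
  have \<pi>_id: "\<pi> p = p" if "p \<in> primitives scale \<Delta> \<epsilon> e" for p
    using \<pi>_S[of e p] base.pi_id[OF that] by (simp add: S_e counit_e vs_one[OF vs])
  have \<pi>_e: "\<pi> e = 0"
    by (simp add: \<pi>_def sw_e[OF b] base.pi_e bil_zero_right[OF E] lin_zero[OF lin_sigma])
  have "\<pi> a \<in> primitives scale \<Delta> \<epsilon> e" for a by (simp add: \<pi>_def base.pi_primitive)
  then obtain R where "splitting scale \<Delta> \<epsilon> e \<pi> R"
    using splitting_of_projection[OF lin_\<pi> _ \<pi>_id \<pi>_e] by blast
  then interpret X: splitting scale \<Delta> \<epsilon> e \<pi> R .
  \<comment> \<open>Reconstruct \<open>S c v\<close> from its coproduct by \<open>R\<close>: the
    value of \<open>\<pi> (S y v)\<close> leaves only the counit of \<open>y\<close>, and the sum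
    collapses.\<close>
  have "S c v = R c (\<sigma> v)" for c v
  proof -
    have "S c v = sw scale R (S c v)"
      by (simp add: X.sw_R aug_def counit_S vs_zero[OF vs])
    also have "\<dots> = sw scale (\<lambda>x y. R x (\<pi> (S y v))) c"
      by (simp add: coproduct[OF X.bil_R] X.R_e_right X.R_pi)
    also have "\<dots> = sw scale (\<lambda>x y. scale (\<epsilon> y) (R x (\<sigma> v))) c"
      by (simp add: \<pi>_S bil_scale_right[OF X.bil_R])
    also have "\<dots> = R c (\<sigma> v)"
      by (rule sw_counit_right) (intro bil_left[OF X.bil_R] lin_ident vs)
    finally show ?thesis .
  qed
  then have "R c v = S c (\<pi> v)" for c v
    by (simp add: base.pi_id X.pi_primitive X.R_pi)
  with X.splitting_axioms show ?thesis by (rule that)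
qed

end

section \<open>Complements of the primitive elements and projections\<close>

lemma (in pointed_coalgebra) projection_along:
  assumes I: "subspace I"
    and sum: "augmentation_ideal \<epsilon> = {p + x | p x. p \<in> primitives scale \<Delta> \<epsilon> e \<and> x \<in> I}"
    and direct: "primitives scale \<Delta> \<epsilon> e \<inter> I = {0}"
  obtains \<pi> where "lin scale scale \<pi>" "\<And>a. \<pi> a \<in> primitives scale \<Delta> \<epsilon> e"
    "\<And>p. p \<in> primitives scale \<Delta> \<epsilon> e \<Longrightarrow> \<pi> p = p" "\<pi> e = 0"
    "I = {x \<in> augmentation_ideal \<epsilon>. \<pi> x = 0}"
proof -
  let ?P = "primitives scale \<Delta> \<epsilon> e"
  note P = subspace_primitives
  have "\<exists>p. p \<in> ?P \<and> aug a - p \<in> I" for a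
  proof -
    obtain p x where "aug a = p + x" "p \<in> ?P" "x \<in> I" using aug_in[of a] unfolding sum by blast
    then show ?thesis by (intro exI[of _ p]) simp
  qed
  then obtain \<pi> where \<pi>: "\<pi> a \<in> ?P" "aug a - \<pi> a \<in> I" for a
    by metis
  \<comment> \<open>The choice of \<open>\<pi> a\<close> is forced by the direct sum; linearity and
    the values of \<open>\<pi>\<close> all follow from this.\<close>
  have unique: "\<pi> a = p" if "p \<in> ?P" "aug a - p \<in> I" for a p
  proof -
    have "\<pi> a - p \<in> ?P \<inter> I"
      using subspace_diff[OF P \<pi>(1) that(1)] subspace_diff[OF I that(2) \<pi>(2)[of a]] by simp
    then show ?thesis using direct by simp
  qed
  have "lin scale scale \<pi>"
  proof (rule linI[OF vs vs])
    fix a b c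
    show "\<pi> (a + b) = \<pi> a + \<pi> b"
      using subspace_add[OF I \<pi>(2)[of a] \<pi>(2)[of b]] subspace_add[OF P \<pi>(1)[of a] \<pi>(1)[of b]]
      by (intro unique) (simp_all add: lin_add[OF lin_aug] algebra_simps)
    show "\<pi> (scale c a) = scale c (\<pi> a)"
      using subspace_scale[OF I \<pi>(2)[of a], of c] subspace_scale[OF P \<pi>(1)[of a], of c]
      by (intro unique) (simp_all add: lin_scale[OF lin_aug] vs_diff[OF vs])
  qed
  moreover have "\<pi> p = p" if "p \<in> ?P" for p
    using that counit_primitive[OF that] subspace_0[OF I]
    by (intro unique) (auto simp: aug_def)
  moreover have "\<pi> e = 0"
    using subspace_0[OF I] subspace_0[OF P] by (intro unique) (auto simp: aug_e)
  moreover have "I = {x \<in> augmentation_ideal \<epsilon>. \<pi> x = 0}"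
  proof (intro equalityI subsetI)
    fix x assume x: "x \<in> I"
    then have "0 + x \<in> augmentation_ideal \<epsilon>"
      unfolding sum using subspace_0[OF P] by blast
    then have "x \<in> augmentation_ideal \<epsilon>" by simp
    moreover from this have "\<pi> x = 0"
      using x subspace_0[OF P] by (intro unique) (simp_all add: aug_id)
    ultimately show "x \<in> {x \<in> augmentation_ideal \<epsilon>. \<pi> x = 0}" by simp
  next
    fix x assume "x \<in> {x \<in> augmentation_ideal \<epsilon>. \<pi> x = 0}"
    then show "x \<in> I" using \<pi>(2)[of x] by (simp add: aug_id)
  qed
  ultimately show ?thesis using \<pi>(1) by (intro that[of \<pi>])
qed

lemma (in splitting) augmentation_ideal_decomposition:
  defines "K \<equiv> {x \<in> augmentation_ideal \<epsilon>. \<pi> x = 0}"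
  shows "augmentation_ideal \<epsilon> = {p + x | p x. p \<in> primitives scale \<Delta> \<epsilon> e \<and> x \<in> K}"
    and "primitives scale \<Delta> \<epsilon> e \<inter> K = {0}"
proof -
  have "\<exists>p x. a = p + x \<and> p \<in> primitives scale \<Delta> \<epsilon> e \<and> x \<in> K" if "\<epsilon> a = 0" for a
    using that by (intro exI[of _ "\<pi> a"] exI[of _ "a - \<pi> a"])
      (simp add: K_def pi_primitive augmentation_ideal_def counit_simps counit_pi lin_diff[OF lin_pi] pi_pi)
  then show "augmentation_ideal \<epsilon> = {p + x | p x. p \<in> primitives scale \<Delta> \<epsilon> e \<and> x \<in> K}"
    by (auto simp: K_def augmentation_ideal_def counit_simps counit_primitive)
  show "primitives scale \<Delta> \<epsilon> e \<inter> K = {0}"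
    using subspace_0[OF subspace_primitives] pi_id
    by (auto simp: K_def augmentation_ideal_def counit_simps)
qed

text \<open>\<open>\<pi>'\<close> kills \<open>A.aug a - \<pi> a\<close>, which lies in the common
  kernel, so the two projections agree and \<open>splitting_unique\<close> applies.\<close>

lemma splitting_determined:
  assumes "splitting scale \<Delta> \<epsilon> e \<pi> R" "splitting scale \<Delta> \<epsilon> e \<pi>' R'"
    and kernel: "{x \<in> augmentation_ideal \<epsilon>. \<pi> x = 0} = {x \<in> augmentation_ideal \<epsilon>. \<pi>' x = 0}"
  shows "R = R'"
proof -
  interpret A: splitting scale \<Delta> \<epsilon> e \<pi> R by fact
  interpret B: splitting scale \<Delta> \<epsilon> e \<pi>' R' by fact
  have "\<pi> a = \<pi>' a" for a
  proof -
    have "A.aug a - \<pi> a \<in> {x \<in> augmentation_ideal \<epsilon>. \<pi> x = 0}"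
      by (simp add: augmentation_ideal_def A.counit_simps A.counit_aug A.counit_pi
          lin_diff[OF A.lin_pi] A.pi_aug A.pi_pi)
    then have "\<pi>' (A.aug a - \<pi> a) = 0" unfolding kernel by simp
    then show ?thesis
      by (simp add: lin_diff[OF B.lin_pi] B.pi_aug B.pi_id A.pi_primitive)
  qed
  then have "\<pi> = \<pi>'" by blast
  then show ?thesis using assms splitting_unique by blast
qed

subsection \<open>From left ideals to dendriform structures\<close>

text \<open>Each of the two coproducts is a representation plus two boundary terms, so the double
  sum has nine terms.\<close>

lemma (in hopf_algebra) sw_sw_sweedler_rep:
  assumes \<beta>: "bil scale t \<beta>" and M: "bil scale scale M"
    and u: "sweedler_rep scale \<Delta> \<epsilon> e a u" and v: "sweedler_rep scale \<Delta> \<epsilon> e b v"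
  shows "sw t (\<lambda>a' a''. sw t (\<lambda>b' b''. \<beta> (a' \<star> b') (M a'' b'')) b) a =
    lin_ext t (\<lambda>(a', a''). lin_ext t (\<lambda>(b', b''). \<beta> (a' \<star> b') (M a'' b'')) v) u
    + lin_ext t (\<lambda>(a', a''). \<beta> (a' \<star> b) (M a'' e)) u
    + lin_ext t (\<lambda>(a', a''). \<beta> a' (M a'' b)) u
    + (lin_ext t (\<lambda>(b', b''). \<beta> (a \<star> b') (M e b'')) v + \<beta> (a \<star> b) (M e e) + \<beta> a (M e b))
    + (lin_ext t (\<lambda>(b', b''). \<beta> b' (M a b'')) v + \<beta> b (M a e) + \<beta> e (M a b))"
proof -
  note t = bil_vs(2)[OF \<beta>]
  have inner: "bil scale t (\<lambda>b' b''. \<beta> (a' \<star> b') (M a'' b''))" for a' a''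
    by (intro bilI bil_left[OF \<beta>] bil_right[OF \<beta>] bil_right[OF bil_mult] bil_right[OF M] lin_ident vs)
  have outer: "bil scale t (\<lambda>a' a''. sw t (\<lambda>b' b''. \<beta> (a' \<star> b') (M a'' b'')) b)"
    by (intro bilI lin_sw_fun bil_left[OF \<beta>] bil_right[OF \<beta>] bil_left[OF bil_mult] bil_left[OF M]
        lin_ident vs t)
  show ?thesis
    unfolding sweedler_rep_lin_ext[OF u outer]
    by (simp only: sweedler_rep_lin_ext[OF v inner])
      (simp add: case_prod_unfold lin_ext_plus[OF t] unit_left unit_right)
qed

context splitting_hopf
begin

lemma right_half_e_left: "e \<rhd> b = b"
  by (simp add: right_half_def left_half_e_left unit_left)

lemma right_half_e_right: "a \<rhd> e = scale (\<epsilon> a) e"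
  by (simp add: right_half_def left_half_e_right unit_right aug_def)

text \<open>The ideal enters through \<open>right_half_left_half\<close>, the middle dendriform
  axiom. The coproduct axioms are \<open>sw_left_half\<close> and \<open>sw_right_half\<close>
  rewritten for reduced coproducts.\<close>

lemma dendriform_of_ideal:
  assumes ideal: "\<And>a x. \<epsilon> x = 0 \<Longrightarrow> \<pi> x = 0 \<Longrightarrow> \<pi> (a \<star> x) = 0"
  shows "dendriform_hopf_algebra scale \<Delta> \<epsilon> e (\<star>)
    (\<lambda>a\<in>augmentation_ideal \<epsilon>. \<lambda>b\<in>augmentation_ideal \<epsilon>. a \<lhd> b)
    (\<lambda>a\<in>augmentation_ideal \<epsilon>. \<lambda>b\<in>augmentation_ideal \<epsilon>. a \<rhd> b)"
    (is "dendriform_hopf_algebra _ _ _ _ _ ?prec ?succ")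
proof -
  let ?A = "augmentation_ideal \<epsilon>"
  have in_left: "a \<lhd> b \<in> ?A" for a b
    by (simp add: augmentation_ideal_def counit_left_half)
  have in_right: "a \<rhd> b \<in> ?A" if "a \<in> ?A" for a b
    using that by (simp add: augmentation_ideal_def right_half_def counit_simps counit_mult counit_left_half)
  have in_mult: "a \<star> b \<in> ?A" if "a \<in> ?A" for a b
    using that by (simp add: augmentation_ideal_def counit_mult)
  have in_sum: "a + b \<in> ?A" if "a \<in> ?A" "b \<in> ?A" for a b
    using that by (simp add: augmentation_ideal_def counit_simps)
  have in_scale: "scale c a \<in> ?A" if "a \<in> ?A" for a c
    using that by (simp add: augmentation_ideal_def counit_simps)
  have e_right: "a \<lhd> e = a" "a \<rhd> e = 0" if "a \<in> ?A" for a
    using that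
    by (simp_all add: left_half_e_right right_half_e_right aug_id vs_zero[OF vs])
      (simp add: augmentation_ideal_def vs_zero[OF vs])
  note right_left = right_half_left_half[OF ideal]
  \<comment> \<open>Subtract the first two axioms from associativity of
    \<open>\<star>\<close>.\<close>
  have third: "a \<star> b \<rhd> c = a \<rhd> (b \<rhd> c)" for a b c
  proof -
    have "(a \<star> b) \<lhd> c = a \<lhd> b \<lhd> c + a \<rhd> b \<lhd> c"
      by (simp add: right_half_def flip: bil_add_left[OF bil_left_half])
    then show ?thesis
      by (simp add: right_left left_half_left_half right_half_def[of "a \<star> b"] right_half_def[of b]
          bil_diff_right[OF bil_right_half] right_half_def[of a "b \<star> c"] mult_assoc)
  qed
  have prec: "tensor_eq scale (reduced_coproduct \<Delta> e (?prec a b))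
        (lin_ext fscale (\<lambda>(a', a''). lin_ext fscale (\<lambda>(b', b''). (a' \<star> b') \<otimes> (?prec a'' b'')) v) u
         + lin_ext fscale (\<lambda>(a', a''). (a' \<star> b) \<otimes> a'') u
         + lin_ext fscale (\<lambda>(b', b''). b' \<otimes> (?prec a b'')) v
         + lin_ext fscale (\<lambda>(a', a''). a' \<otimes> (?prec a'' b)) u
         + b \<otimes> a)"
    and succ: "tensor_eq scale (reduced_coproduct \<Delta> e (?succ a b))
        (lin_ext fscale (\<lambda>(a', a''). lin_ext fscale (\<lambda>(b', b''). (a' \<star> b') \<otimes> (?succ a'' b'')) v) u
         + lin_ext fscale (\<lambda>(b', b''). (a \<star> b') \<otimes> b'') v
         + lin_ext fscale (\<lambda>(b', b''). b' \<otimes> (?succ a b'')) v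
         + lin_ext fscale (\<lambda>(a', a''). a' \<otimes> (?succ a'' b)) u
         + a \<otimes> b)"
    if a: "a \<in> ?A" and b: "b \<in> ?A"
      and u: "sweedler_rep scale \<Delta> \<epsilon> e a u" and v: "sweedler_rep scale \<Delta> \<epsilon> e b v" for a b u v
  proof -
    note push = lin_add[OF lin_lin_ext[OF vs_field]] lin_lin_ext_comp[OF lin_lin_ext[OF vs_field]]
      case_prod_unfold lin_ext_single[OF vs_field]
    \<comment> \<open>The restricted half-products agree with the total ones on
      \<open>A\<^sub>+\<close>, so the sums are rewritten key by key.\<close>
    have ku: "fst z \<in> ?A" "snd z \<in> ?A" if "z \<in> Poly_Mapping.keys u" for z
      using sweedler_rep_keys[OF u, of "fst z" "snd z"] that by auto
    have kv: "fst z \<in> ?A" "snd z \<in> ?A" if "z \<in> Poly_Mapping.keys v" for z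
      using sweedler_rep_keys[OF v, of "fst z" "snd z"] that by auto
    note cong = lin_ext_cong[where t = "(*)"]
    show "tensor_eq scale (reduced_coproduct \<Delta> e (?prec a b))
        (lin_ext fscale (\<lambda>(a', a''). lin_ext fscale (\<lambda>(b', b''). (a' \<star> b') \<otimes> (?prec a'' b'')) v) u
         + lin_ext fscale (\<lambda>(a', a''). (a' \<star> b) \<otimes> a'') u
         + lin_ext fscale (\<lambda>(b', b''). b' \<otimes> (?prec a b'')) v
         + lin_ext fscale (\<lambda>(a', a''). a' \<otimes> (?prec a'' b)) u
         + b \<otimes> a)"
    proof (rule tensor_eqI[OF vs])
      fix \<beta> :: "'a \<Rightarrow> 'a \<Rightarrow> 'k" assume \<beta>: "bil scale (*) \<beta>"
      \<comment> \<open>Of the nine terms, the three with \<open>e\<close> on the left of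
        \<open>\<lhd>\<close> vanish and one cancels against the reduced coproduct, which leaves the
        five of the axiom.\<close>
      have "lin_ext (*) (\<lambda>(a', a''). \<beta> (a' \<star> b) (a'' \<lhd> e)) u = lin_ext (*) (\<lambda>(a', a''). \<beta> (a' \<star> b) a'') u"
        by (rule cong) (simp add: case_prod_unfold e_right ku)
      then have "lin_ext (*) (\<lambda>(x, y). \<beta> x y) (reduced_coproduct \<Delta> e (a \<lhd> b)) =
          lin_ext (*) (\<lambda>(a', a''). lin_ext (*) (\<lambda>(b', b''). \<beta> (a' \<star> b') (a'' \<lhd> b'')) v) u
          + lin_ext (*) (\<lambda>(a', a''). \<beta> (a' \<star> b) a'') u
          + lin_ext (*) (\<lambda>(b', b''). \<beta> b' (a \<lhd> b'')) v
          + lin_ext (*) (\<lambda>(a', a''). \<beta> a' (a'' \<lhd> b)) u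
          + \<beta> b a"
        by (simp add: lin_ext_reduced_coproduct[OF \<beta>, unfolded case_prod_unfold] sw_left_half[OF \<beta>]
            sw_sw_sweedler_rep[OF \<beta> bil_left_half u v] left_half_e_left e_right a
            bil_zero_right[OF \<beta>] case_prod_unfold lin_ext_const0[OF vs_field])
      also have "\<dots> = lin_ext (*) (\<lambda>(a', a''). lin_ext (*) (\<lambda>(b', b''). \<beta> (a' \<star> b') (?prec a'' b'')) v) u
          + lin_ext (*) (\<lambda>(a', a''). \<beta> (a' \<star> b) a'') u
          + lin_ext (*) (\<lambda>(b', b''). \<beta> b' (?prec a b'')) v
          + lin_ext (*) (\<lambda>(a', a''). \<beta> a' (?prec a'' b)) u
          + \<beta> b a"
        by (intro arg_cong2[where f = "(+)"] refl cong) (simp_all add: case_prod_unfold a b ku kv cong: cong)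
      finally show "lin_ext (*) (\<lambda>(x, y). \<beta> x y) (reduced_coproduct \<Delta> e (?prec a b)) =
        lin_ext (*) (\<lambda>(x, y). \<beta> x y)
          (lin_ext fscale (\<lambda>(a', a''). lin_ext fscale (\<lambda>(b', b''). (a' \<star> b') \<otimes> (?prec a'' b'')) v) u
         + lin_ext fscale (\<lambda>(a', a''). (a' \<star> b) \<otimes> a'') u
         + lin_ext fscale (\<lambda>(b', b''). b' \<otimes> (?prec a b'')) v
         + lin_ext fscale (\<lambda>(a', a''). a' \<otimes> (?prec a'' b)) u
         + b \<otimes> a)"
        by (simp add: push a b)
    qed
    show "tensor_eq scale (reduced_coproduct \<Delta> e (?succ a b))
        (lin_ext fscale (\<lambda>(a', a''). lin_ext fscale (\<lambda>(b', b''). (a' \<star> b') \<otimes> (?succ a'' b'')) v) u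
         + lin_ext fscale (\<lambda>(b', b''). (a \<star> b') \<otimes> b'') v
         + lin_ext fscale (\<lambda>(b', b''). b' \<otimes> (?succ a b'')) v
         + lin_ext fscale (\<lambda>(a', a''). a' \<otimes> (?succ a'' b)) u
         + a \<otimes> b)"
    proof (rule tensor_eqI[OF vs])
      fix \<beta> :: "'a \<Rightarrow> 'a \<Rightarrow> 'k" assume \<beta>: "bil scale (*) \<beta>"
      \<comment> \<open>Since \<open>e \<rhd> e = e\<close>, the term
        \<open>\<beta> (a \<star> b) e\<close> survives; this splitting cancels it against the
        boundary terms of both half-products.\<close>
      have split: "\<beta> (a \<star> b) e = \<beta> (a \<lhd> b) e + \<beta> (a \<rhd> b) e"
        by (simp add: right_half_def bil_diff_left[OF \<beta>])
      have "lin_ext (*) (\<lambda>(a', a''). \<beta> (a' \<star> b) (a'' \<rhd> e)) u = lin_ext (*) (\<lambda>(a', a''). 0) u"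
        by (rule cong) (simp add: case_prod_unfold e_right ku bil_zero_right[OF \<beta>])
      then have "lin_ext (*) (\<lambda>(x, y). \<beta> x y) (reduced_coproduct \<Delta> e (a \<rhd> b)) =
          lin_ext (*) (\<lambda>(a', a''). lin_ext (*) (\<lambda>(b', b''). \<beta> (a' \<star> b') (a'' \<rhd> b'')) v) u
          + lin_ext (*) (\<lambda>(b', b''). \<beta> (a \<star> b') b'') v
          + lin_ext (*) (\<lambda>(b', b''). \<beta> b' (a \<rhd> b'')) v
          + lin_ext (*) (\<lambda>(a', a''). \<beta> a' (a'' \<rhd> b)) u
          + \<beta> a b"
        by (simp add: lin_ext_reduced_coproduct[OF \<beta>, unfolded case_prod_unfold] sw_right_half[OF \<beta>]
            sw_sw_sweedler_rep[OF \<beta> bil_right_half u v] right_half_e_left e_right a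
            bil_zero_right[OF \<beta>] split case_prod_unfold lin_ext_const0[OF vs_field])
      also have "\<dots> = lin_ext (*) (\<lambda>(a', a''). lin_ext (*) (\<lambda>(b', b''). \<beta> (a' \<star> b') (?succ a'' b'')) v) u
          + lin_ext (*) (\<lambda>(b', b''). \<beta> (a \<star> b') b'') v
          + lin_ext (*) (\<lambda>(b', b''). \<beta> b' (?succ a b'')) v
          + lin_ext (*) (\<lambda>(a', a''). \<beta> a' (?succ a'' b)) u
          + \<beta> a b"
        by (intro arg_cong2[where f = "(+)"] refl cong) (simp_all add: case_prod_unfold a b ku kv cong: cong)
      finally show "lin_ext (*) (\<lambda>(x, y). \<beta> x y) (reduced_coproduct \<Delta> e (?succ a b)) =
        lin_ext (*) (\<lambda>(x, y). \<beta> x y)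
        (lin_ext fscale (\<lambda>(a', a''). lin_ext fscale (\<lambda>(b', b''). (a' \<star> b') \<otimes> (?succ a'' b'')) v) u
         + lin_ext fscale (\<lambda>(b', b''). (a \<star> b') \<otimes> b'') v
         + lin_ext fscale (\<lambda>(b', b''). b' \<otimes> (?succ a b'')) v
         + lin_ext fscale (\<lambda>(a', a''). a' \<otimes> (?succ a'' b)) u
         + a \<otimes> b)"
        by (simp add: push a b)
    qed
  qed
  have bilinear: "bilinear_on scale ?A ?prec" "bilinear_on scale ?A ?succ"
    by (auto simp: bilinear_on_def in_sum in_scale bil_add_left[OF bil_left_half]
        bil_add_right[OF bil_left_half] bil_scale_left[OF bil_left_half] bil_scale_right[OF bil_left_half]
        bil_add_left[OF bil_right_half] bil_add_right[OF bil_right_half]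
        bil_scale_left[OF bil_right_half] bil_scale_right[OF bil_right_half])
  show ?thesis
  proof (intro dendriform_hopf_algebra.intro hopf_algebra_axioms dendriform_hopf_algebra_axioms.intro
      prec succ bilinear)
    show "?prec \<in> ?A \<rightarrow>\<^sub>E ?A \<rightarrow>\<^sub>E ?A" "?succ \<in> ?A \<rightarrow>\<^sub>E ?A \<rightarrow>\<^sub>E ?A"
      using in_left in_right by (auto simp: PiE_def Pi_def)
  qed (simp_all add: in_left in_right in_mult left_half_left_half right_left third,
      simp add: right_half_def)
qed

end

subsection \<open>From dendriform structures to left ideals\<close>

context dendriform_hopf_algebra
begin

text \<open>Expand both factors along \<open>A = K e \<oplus> A\<^sub>+\<close>. In
  \<open>DD\<close> the product is only asserted to exist; here the half-products determine
  it.\<close>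

lemma unital_sum_eq_mult: "unital_sum scale \<epsilon> e (\<lhd>) (\<rhd>) = (\<star>)"
proof (intro ext)
  fix a b
  have "a \<star> b = (aug a + scale (\<epsilon> a) e) \<star> (aug b + scale (\<epsilon> b) e)"
    by (simp flip: aug_decomp)
  also have "\<dots> = scale (\<epsilon> a * \<epsilon> b) e + scale (\<epsilon> a) (aug b) + scale (\<epsilon> b) (aug a) + aug a \<star> aug b"
    by (simp add: bil_add_left[OF bil_mult] bil_add_right[OF bil_mult] bil_scale_left[OF bil_mult]
        bil_scale_right[OF bil_mult] unit_left unit_right algebra_simps vs_assoc[OF vs])
  finally show "unital_sum scale \<epsilon> e (\<lhd>) (\<rhd>) a b = a \<star> b"
    by (simp add: unital_sum_def Let_def mult_split[OF aug_in aug_in] flip: aug_def)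
qed

lemma prec_in: "\<lbrakk>a \<in> augmentation_ideal \<epsilon>; b \<in> augmentation_ideal \<epsilon>\<rbrakk> \<Longrightarrow> a \<lhd> b \<in> augmentation_ideal \<epsilon>"
  and succ_in: "\<lbrakk>a \<in> augmentation_ideal \<epsilon>; b \<in> augmentation_ideal \<epsilon>\<rbrakk> \<Longrightarrow> a \<rhd> b \<in> augmentation_ideal \<epsilon>"
  using prec_closed succ_closed by (auto simp: PiE_def Pi_def)

text \<open>For \<open>x\<close> in \<open>A\<^sub>+\<close> the middle axiom gives \<open>x \<star>
  (a \<lhd> b) = x \<lhd> (a \<lhd> b) + (x \<rhd> a) \<lhd> b\<close>, a sum of two
  generators.\<close>

lemma left_ideal_span_prec:
  "left_ideal scale (\<star>)
     (span {a \<lhd> b | a b. a \<in> augmentation_ideal \<epsilon> \<and> b \<in> augmentation_ideal \<epsilon>})"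
    (is "left_ideal _ _ (span ?S)")
  unfolding left_ideal_def
proof (intro conjI allI ballI)
  show "subspace (span ?S)" by (rule subspace_span)
  fix x k assume "k \<in> span ?S"
  moreover have "subspace {k. x \<star> k \<in> span ?S}"
    by (rule subspaceI)
      (auto simp: bil_zero_right[OF bil_mult] bil_add_right[OF bil_mult] bil_scale_right[OF bil_mult]
        span_zero span_add span_scale)
  moreover have "?S \<subseteq> {k. x \<star> k \<in> span ?S}"
  proof
    fix k assume "k \<in> ?S"
    then obtain a b where k: "k = a \<lhd> b" and ab: "a \<in> augmentation_ideal \<epsilon>" "b \<in> augmentation_ideal \<epsilon>"
      by blast
    have gen: "c \<lhd> d \<in> span ?S" if "c \<in> augmentation_ideal \<epsilon>" "d \<in> augmentation_ideal \<epsilon>" for c d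
      using that by (intro span_base) blast
    have "x \<star> k = (aug x + scale (\<epsilon> x) e) \<star> k"
      by (simp flip: aug_decomp)
    also have "\<dots> = aug x \<lhd> (a \<lhd> b) + (aug x \<rhd> a) \<lhd> b + scale (\<epsilon> x) (a \<lhd> b)"
      by (simp add: bil_add_left[OF bil_mult] bil_scale_left[OF bil_mult] unit_left k
          mult_split[OF aug_in prec_in[OF ab]] succ_prec[OF aug_in ab])
    also have "\<dots> \<in> span ?S"
      by (intro span_add span_scale gen aug_in prec_in succ_in ab)
    finally show "k \<in> {k. x \<star> k \<in> span ?S}" by simp
  qed
  ultimately show "x \<star> k \<in> span ?S"
    using span_minimal by blast
qed

text \<open>Extends \<open>\<lhd>\<close> to \<open>A\<close> with the same values at
  \<open>e\<close> as \<open>left_half\<close>, so that the two can be compared.\<close>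

definition unital_prec :: "'a \<Rightarrow> 'a \<Rightarrow> 'a" where
  "unital_prec a b = aug a \<lhd> aug b + scale (\<epsilon> b) (aug a)"

lemma bil_unital_prec: "bil scale scale unital_prec"
proof -
  have "bil scale scale (\<lambda>a b. aug a \<lhd> aug b)"
    using prec_bilinear[unfolded bilinear_on_def] aug_in
    by (intro bilI linI vs) (auto simp: lin_add[OF lin_aug] lin_scale[OF lin_aug])
  then show ?thesis
    unfolding unital_prec_def bil_def
    by (auto intro!: lin_plus lin_functional_scaled lin_scaled lin_aug counit_lin vs)
qed

lemma unital_prec_eq:
  "\<lbrakk>a \<in> augmentation_ideal \<epsilon>; b \<in> augmentation_ideal \<epsilon>\<rbrakk> \<Longrightarrow> unital_prec a b = a \<lhd> b"
  by (simp add: unital_prec_def aug_id) (simp add: augmentation_ideal_def vs_zero[OF vs])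

lemma unital_prec_in: "unital_prec a b \<in> augmentation_ideal \<epsilon>"
  using prec_in[OF aug_in aug_in] by (simp add: augmentation_ideal_def unital_prec_def counit_simps counit_aug)

lemma prec_add_right: "\<lbrakk>a \<in> augmentation_ideal \<epsilon>; b \<in> augmentation_ideal \<epsilon>; c \<in> augmentation_ideal \<epsilon>\<rbrakk> \<Longrightarrow>
    a \<lhd> (b + c) = a \<lhd> b + a \<lhd> c"
  and prec_add_left: "\<lbrakk>a \<in> augmentation_ideal \<epsilon>; b \<in> augmentation_ideal \<epsilon>; c \<in> augmentation_ideal \<epsilon>\<rbrakk> \<Longrightarrow>
    (a + b) \<lhd> c = a \<lhd> c + b \<lhd> c"
  and prec_scale_right: "\<lbrakk>a \<in> augmentation_ideal \<epsilon>; b \<in> augmentation_ideal \<epsilon>\<rbrakk> \<Longrightarrow>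
    a \<lhd> scale x b = scale x (a \<lhd> b)"
  and prec_scale_left: "\<lbrakk>a \<in> augmentation_ideal \<epsilon>; b \<in> augmentation_ideal \<epsilon>\<rbrakk> \<Longrightarrow>
    scale x a \<lhd> b = scale x (a \<lhd> b)"
  using prec_bilinear by (auto simp: bilinear_on_def)

lemma unital_prec_e_left: "unital_prec e b = 0"
  using bil_zero_left[OF bil_unital_prec, of b] by (simp add: unital_prec_def aug_e aug_def[of 0] counit_simps)

lemma unital_prec_e_right: "unital_prec a e = aug a"
  using bil_zero_right[OF bil_unital_prec, of a]
  by (simp add: unital_prec_def aug_e aug_def[of 0] counit_simps counit_e vs_one[OF vs] vs_zero[OF vs])

text \<open>The part in \<open>A\<^sub>+\<close> is the first dendriform axiom; the terms with
  counits match by bilinearity.\<close>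

lemma unital_prec_assoc: "unital_prec (unital_prec a b) c = unital_prec a (b \<star> c)"
proof -
  let ?A = "augmentation_ideal \<epsilon>"
  let ?a = "aug a" and ?b = "aug b" and ?c = "aug c"
  have scale_in: "scale x y \<in> ?A" if "y \<in> ?A" for x y
    using that by (simp add: augmentation_ideal_def counit_simps)
  have mult_in: "?b \<star> ?c \<in> ?A"
    by (simp add: augmentation_ideal_def counit_mult counit_aug)
  have add_in: "x + y \<in> ?A" if "x \<in> ?A" "y \<in> ?A" for x y
    using that by (simp add: augmentation_ideal_def counit_simps)
  have aug_mult: "aug (b \<star> c) = ?b \<star> ?c + (scale (\<epsilon> b) ?c + scale (\<epsilon> c) ?b)"
    by (simp add: aug_def counit_mult bil_diff_left[OF bil_mult] bil_diff_right[OF bil_mult]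
        bil_scale_left[OF bil_mult] bil_scale_right[OF bil_mult] unit_left unit_right vs_diff[OF vs]
        vs_assoc[OF vs] mult.commute algebra_simps)
  have "unital_prec a (b \<star> c) = ?a \<lhd> (?b \<star> ?c) + scale (\<epsilon> b) (?a \<lhd> ?c) + scale (\<epsilon> c) (?a \<lhd> ?b)
      + scale (\<epsilon> b * \<epsilon> c) ?a"
    unfolding unital_prec_def aug_mult
    by (simp add: prec_add_right prec_scale_right aug_in mult_in scale_in add_in counit_mult add.assoc)
  moreover have "unital_prec (unital_prec a b) c =
      ?a \<lhd> ?b \<lhd> ?c + scale (\<epsilon> b) (?a \<lhd> ?c) + scale (\<epsilon> c) (?a \<lhd> ?b + scale (\<epsilon> b) ?a)"
    by (simp add: unital_prec_def[of "unital_prec a b"] aug_id[OF unital_prec_in])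
      (simp add: unital_prec_def prec_add_left prec_scale_left aug_in prec_in scale_in)
  ultimately show ?thesis
    by (simp add: prec_prec aug_in vs_add[OF vs] vs_assoc[OF vs] mult.commute algebra_simps)
qed

lemma lin_eq_on_augmentation:
  assumes f: "lin scale t f" and g: "lin scale t g" and "f e = g e"
    and "\<And>a. a \<in> augmentation_ideal \<epsilon> \<Longrightarrow> f a = g a"
  shows "f c = g c"
proof -
  have "f (aug c + scale (\<epsilon> c) e) = g (aug c + scale (\<epsilon> c) e)"
    using assms(3,4) aug_in by (simp add: lin_add[OF f] lin_add[OF g] lin_scale[OF f] lin_scale[OF g])
  then show ?thesis by (simp flip: aug_decomp)
qed

text \<open>A primitive \<open>p\<close> has the Sweedler representation 0, so two terms of the
  coproduct axiom remain. The result is the coproduct law required by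
  \<open>splitting_of_coproduct\<close>.\<close>

lemma sw_unital_prec_primitive:
  assumes \<beta>: "bil scale t \<beta>" and p: "p \<in> primitives scale \<Delta> \<epsilon> e"
  shows "sw t \<beta> (unital_prec p c) =
    sw t (\<lambda>x y. \<beta> x (unital_prec p y)) c + \<beta> (unital_prec p c) e"
proof (rule lin_eq_on_augmentation[where f = "\<lambda>c. sw t \<beta> (unital_prec p c)"])
  note t = bil_vs(2)[OF \<beta>]
  have b: "bil scale t (\<lambda>x y. \<beta> x (unital_prec p y))"
    by (intro bilI bil_left[OF \<beta>] bil_right[OF \<beta>] bil_right[OF bil_unital_prec] lin_ident vs)
  show "lin scale t (\<lambda>c. sw t \<beta> (unital_prec p c))"
    by (intro lin_sw_comp[OF \<beta>] bil_right[OF bil_unital_prec] lin_ident vs)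
  show "lin scale t (\<lambda>c. sw t (\<lambda>x y. \<beta> x (unital_prec p y)) c + \<beta> (unital_prec p c) e)"
    by (intro lin_plus lin_sw_comp[OF b] bil_left[OF \<beta>] bil_right[OF bil_unital_prec] lin_ident vs)
  have p_in: "p \<in> augmentation_ideal \<epsilon>" using p by (simp add: primitives_def)
  have p_e: "unital_prec p e = p"
    by (simp add: unital_prec_e_right aug_id p_in)
  show "sw t \<beta> (unital_prec p e) =
    sw t (\<lambda>x y. \<beta> x (unital_prec p y)) e + \<beta> (unital_prec p e) e"
    by (simp add: sw_e[OF b] p_e sw_primitive[OF p \<beta>])
  fix c assume c: "c \<in> augmentation_ideal \<epsilon>"
  obtain w where w: "sweedler_rep scale \<Delta> \<epsilon> e c w" by (rule sweedler_rep_exists[OF c])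
  have "sweedler_rep scale \<Delta> \<epsilon> e p 0"
    using p by (simp add: sweedler_rep_def primitives_def tensor_eq_iff_sw)
  from tensor_eq_lin_ext[OF coproduct_prec[OF p_in c this w] \<beta>]
  have "sw t \<beta> (p \<lhd> c) - \<beta> (p \<lhd> c) e - \<beta> e (p \<lhd> c) =
      lin_ext t (\<lambda>(x, y). \<beta> x (p \<lhd> y)) w + \<beta> c p"
    by (simp add: lin_ext_reduced_coproduct[OF \<beta>, unfolded case_prod_unfold] lin_add[OF lin_lin_ext[OF t]] lin_ext_zero
        lin_lin_ext_comp[OF lin_lin_ext[OF t]] case_prod_unfold lin_ext_single[OF t] vs_one[OF t])
  also have "lin_ext t (\<lambda>(x, y). \<beta> x (p \<lhd> y)) w = lin_ext t (\<lambda>(x, y). \<beta> x (unital_prec p y)) w"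
    by (rule lin_ext_cong) (auto simp: unital_prec_eq p_in dest: sweedler_rep_keys[OF w])
  finally show "sw t \<beta> (unital_prec p c) =
    sw t (\<lambda>x y. \<beta> x (unital_prec p y)) c + \<beta> (unital_prec p c) e"
    by (simp add: sweedler_rep_lin_ext[OF w b] p_e unital_prec_eq[OF p_in c] algebra_simps)
qed

end

section \<open>The splitting of a cofree dendriform Hopf algebra\<close>

locale cofree_dendriform = dendriform_hopf_algebra scale \<Delta> \<epsilon> e mult prec succ +
    pointed_cofree_coalgebra scale \<Delta> \<epsilon> vscale \<phi> e
  for scale :: "'k::field \<Rightarrow> 'a::ab_group_add \<Rightarrow> 'a" and \<Delta> \<epsilon> e
    and mult :: "'a \<Rightarrow> 'a \<Rightarrow> 'a" (infixl "\<star>" 75)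
    and prec :: "'a \<Rightarrow> 'a \<Rightarrow> 'a" (infixl "\<lhd>" 75)
    and succ :: "'a \<Rightarrow> 'a \<Rightarrow> 'a" (infixl "\<rhd>" 75)
    and vscale :: "'k \<Rightarrow> 'v::ab_group_add \<Rightarrow> 'v" and \<phi>
begin

text \<open>Products with primitive left factor yield a splitting by
  \<open>splitting_of_coproduct\<close>. Its left half-product is the given one, so
  \<open>kernel_pi_eq_span\<close> identifies the span.\<close>

lemma splitting_of_prec:
  obtains \<pi> R where "splitting scale \<Delta> \<epsilon> e \<pi> R"
    "\<And>a b. \<lbrakk>a \<in> augmentation_ideal \<epsilon>; b \<in> augmentation_ideal \<epsilon>\<rbrakk> \<Longrightarrow>
      a \<lhd> b = sw scale (\<lambda>x y. R (x \<star> b) y) a"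
    "span {a \<lhd> b | a b. a \<in> augmentation_ideal \<epsilon> \<and> b \<in> augmentation_ideal \<epsilon>} =
      {x \<in> augmentation_ideal \<epsilon>. \<pi> x = 0}"
proof -
  obtain \<pi> R where split: "splitting scale \<Delta> \<epsilon> e \<pi> R"
    and R: "\<And>c v. R c v = unital_prec (\<sigma> (\<pi> v)) c"
  proof (rule splitting_of_coproduct[where S = "\<lambda>c v. unital_prec (\<sigma> v) c"])
    show "bil scale scale (\<lambda>c v. unital_prec (\<sigma> v) c)"
      by (intro bilI bil_left[OF bil_unital_prec] bil_right[OF bil_unital_prec] lin_sigma lin_ident vs)
    show "unital_prec (\<sigma> v) e = \<sigma> v" for v
      by (simp add: unital_prec_e_right aug_def base.counit_pi vs_zero[OF vs])
    show "\<epsilon> (unital_prec (\<sigma> v) c) = 0" for v c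
      using unital_prec_in by (simp add: augmentation_ideal_def)
  qed (simp_all add: sigma_sigma sw_unital_prec_primitive base.pi_primitive)
  then interpret X: splitting_hopf scale \<Delta> \<epsilon> e \<pi> R mult
    by (intro splitting_hopf.intro hopf_algebra_axioms)
  have R: "R c v = unital_prec (\<pi> v) c" for c v
    using R by (simp add: base.pi_id X.pi_primitive)
  have "unital_prec a b = X.left_half a b" for a b
  proof (rule lin_eq_on_augmentation[where f = "\<lambda>a. unital_prec a b"])
    show l: "lin scale scale (\<lambda>a. unital_prec a b)"
      by (intro bil_left[OF bil_unital_prec] lin_ident vs)
    show "lin scale scale (\<lambda>a. X.left_half a b)"
      by (intro bil_left[OF X.bil_left_half] lin_ident vs)
    show "unital_prec e b = X.left_half e b"
      by (simp add: unital_prec_e_left X.left_half_e_left)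
    fix a assume "a \<in> augmentation_ideal \<epsilon>"
    then have "unital_prec a b = unital_prec (sw scale R a) b"
      by (simp add: X.sw_R aug_id)
    \<comment> \<open>By \<open>unital_prec_assoc\<close>, multiplying
      \<open>R x y = unital_prec (\<pi> y) x\<close> by \<open>b\<close> gives
      \<open>R (x \<star> b) y\<close>.\<close>
    also have "\<dots> = X.left_half a b"
      by (simp add: lin_of_sw[OF l] X.left_half_def) (simp add: R unital_prec_assoc)
    finally show "unital_prec a b = X.left_half a b" .
  qed
  then have half: "a \<lhd> b = X.left_half a b" if "a \<in> augmentation_ideal \<epsilon>" "b \<in> augmentation_ideal \<epsilon>" for a b
    using that by (simp flip: unital_prec_eq)
  then have "{a \<lhd> b | a b. a \<in> augmentation_ideal \<epsilon> \<and> b \<in> augmentation_ideal \<epsilon>} =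
      {X.left_half a b | a b. a \<in> augmentation_ideal \<epsilon> \<and> b \<in> augmentation_ideal \<epsilon>}"
    by (metis (no_types, lifting))
  with X.kernel_pi_eq_span split half show ?thesis
    by (intro that[of \<pi> R]) (simp_all add: X.left_half_def)
qed

end

subsection \<open>The bijection\<close>

theorem theorem32:
  fixes scale :: "'k::field_char_0 \<Rightarrow> 'a::ab_group_add \<Rightarrow> 'a"
    and vscale :: "'k \<Rightarrow> 'v::ab_group_add \<Rightarrow> 'v"
    and \<Delta> :: "'a \<Rightarrow> ('a \<times> 'a) \<Rightarrow>\<^sub>0 'k"
    and \<epsilon> :: "'a \<Rightarrow> 'k"
    and e :: 'a
  assumes "coalgebra scale \<Delta> \<epsilon>"
    and "coalgebra.cofree_on scale \<Delta> \<epsilon> vscale"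
    and "coalgebra.group_like scale \<Delta> \<epsilon> e"
  shows "bij_betw (\<Phi> scale \<epsilon> e) (DD scale \<Delta> \<epsilon> e) (LI scale \<Delta> \<epsilon> e)"
proof -
  interpret C: coalgebra scale \<Delta> \<epsilon> by fact
  obtain \<phi> where "cofree_coalgebra scale \<Delta> \<epsilon> vscale \<phi>"
    using assms(2) C.coalgebra_axioms
    unfolding C.cofree_on_def cofree_coalgebra_def cofree_coalgebra_axioms_def by blast
  then interpret C: pointed_cofree_coalgebra scale \<Delta> \<epsilon> vscale \<phi> e
    using assms by (simp add: pointed_cofree_coalgebra_def pointed_coalgebra_def pointed_coalgebra_axioms_def)
  let ?A = "augmentation_ideal \<epsilon>"
  have dendriform: "cofree_dendriform scale \<Delta> \<epsilon> e mult prec succ vscale \<phi>"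
    if "dendriform_hopf_algebra scale \<Delta> \<epsilon> e mult prec succ" for mult prec succ
    using that C.pointed_cofree_coalgebra_axioms by (rule cofree_dendriform.intro)
  have Phi: "\<Phi> scale \<epsilon> e (prec, succ) = (mult, C.span {prec a b | a b. a \<in> ?A \<and> b \<in> ?A})"
    if "dendriform_hopf_algebra scale \<Delta> \<epsilon> e mult prec succ" for mult prec succ
    using dendriform_hopf_algebra.unital_sum_eq_mult[OF that] by (simp add: \<Phi>_def)
  show ?thesis
  proof (rule bij_betw_imageI)
    show "inj_on (\<Phi> scale \<epsilon> e) (DD scale \<Delta> \<epsilon> e)"
    proof (rule inj_onI)
      fix z z' assume "z \<in> DD scale \<Delta> \<epsilon> e" "z' \<in> DD scale \<Delta> \<epsilon> e" and eq: "\<Phi> scale \<epsilon> e z = \<Phi> scale \<epsilon> e z'"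
      then obtain prec succ prec' succ' mult mult'
        where z: "z = (prec, succ)" "z' = (prec', succ')"
          and D: "dendriform_hopf_algebra scale \<Delta> \<epsilon> e mult prec succ"
          and D': "dendriform_hopf_algebra scale \<Delta> \<epsilon> e mult' prec' succ'"
        unfolding DD_def by blast
      interpret X: cofree_dendriform scale \<Delta> \<epsilon> e mult prec succ vscale \<phi> by (rule dendriform[OF D])
      interpret X': cofree_dendriform scale \<Delta> \<epsilon> e mult' prec' succ' vscale \<phi> by (rule dendriform[OF D'])
      from eq have mult: "mult' = mult"
        and span: "C.span {prec a b | a b. a \<in> ?A \<and> b \<in> ?A} = C.span {prec' a b | a b. a \<in> ?A \<and> b \<in> ?A}"
        by (simp_all add: z Phi[OF D] Phi[OF D'])
      obtain \<pi> R where R: "splitting scale \<Delta> \<epsilon> e \<pi> R"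
        "\<And>a b. \<lbrakk>a \<in> ?A; b \<in> ?A\<rbrakk> \<Longrightarrow> prec a b = C.sw scale (\<lambda>x y. R (mult x b) y) a"
        "C.span {prec a b | a b. a \<in> ?A \<and> b \<in> ?A} = {x \<in> ?A. \<pi> x = 0}"
        by (rule X.splitting_of_prec) blast
      obtain \<pi>' R' where R': "splitting scale \<Delta> \<epsilon> e \<pi>' R'"
        "\<And>a b. \<lbrakk>a \<in> ?A; b \<in> ?A\<rbrakk> \<Longrightarrow> prec' a b = C.sw scale (\<lambda>x y. R' (mult' x b) y) a"
        "C.span {prec' a b | a b. a \<in> ?A \<and> b \<in> ?A} = {x \<in> ?A. \<pi>' x = 0}"
        by (rule X'.splitting_of_prec) blast
      \<comment> \<open>The common ideal fixes the projection and thus \<open>R\<close>; together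
        with the product, \<open>R\<close> fixes \<open>prec\<close>, and \<open>succ\<close> is the
        difference.\<close>
      have "R = R'"
        using R(3) R'(3) span by (intro splitting_determined[OF R(1) R'(1)]) simp
      then have p: "prec a b = prec' a b" if "a \<in> ?A" "b \<in> ?A" for a b
        using R(2)[OF that] R'(2)[OF that] mult by simp
      have s: "succ a b = succ' a b" if "a \<in> ?A" "b \<in> ?A" for a b
        using X.mult_split[OF that] X'.mult_split[OF that] mult p[OF that] by simp
      \<comment> \<open>Half-products are extensional on \<open>A\<^sub>+\<close> in both arguments,
        so agreement there is equality.\<close>
      have ext: "f = g"
        if f: "f \<in> ?A \<rightarrow>\<^sub>E ?A \<rightarrow>\<^sub>E ?A" and g: "g \<in> ?A \<rightarrow>\<^sub>E ?A \<rightarrow>\<^sub>E ?A"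
          and eq: "\<And>a b. a \<in> ?A \<Longrightarrow> b \<in> ?A \<Longrightarrow> f a b = g a b" for f g
      proof (rule PiE_ext[OF f g])
        fix a assume a: "a \<in> ?A"
        show "f a = g a"
          by (rule PiE_ext[OF PiE_mem[OF f a] PiE_mem[OF g a]]) (rule eq[OF a])
      qed
      show "z = z'"
        using ext[OF X.prec_closed X'.prec_closed p] ext[OF X.succ_closed X'.succ_closed s]
        by (simp add: z)
    qed
    show "\<Phi> scale \<epsilon> e ` DD scale \<Delta> \<epsilon> e = LI scale \<Delta> \<epsilon> e"
    proof (intro equalityI subsetI)
      fix z assume "z \<in> \<Phi> scale \<epsilon> e ` DD scale \<Delta> \<epsilon> e"
      then obtain mult prec succ where z: "z = \<Phi> scale \<epsilon> e (prec, succ)"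
        and D: "dendriform_hopf_algebra scale \<Delta> \<epsilon> e mult prec succ"
        by (auto simp: DD_def)
      interpret X: cofree_dendriform scale \<Delta> \<epsilon> e mult prec succ vscale \<phi> by (rule dendriform[OF D])
      obtain \<pi> R where R: "splitting scale \<Delta> \<epsilon> e \<pi> R"
        "C.span {prec a b | a b. a \<in> ?A \<and> b \<in> ?A} = {x \<in> ?A. \<pi> x = 0}"
        by (rule X.splitting_of_prec) blast
      show "z \<in> LI scale \<Delta> \<epsilon> e"
        using X.left_ideal_span_prec splitting.augmentation_ideal_decomposition[OF R(1)]
          X.hopf_algebra_axioms
        by (simp add: z Phi[OF D] LI_def R(2))
    next
      fix z assume "z \<in> LI scale \<Delta> \<epsilon> e"
      then obtain mult I where z: "z = (mult, I)" and hopf: "hopf_algebra scale \<Delta> \<epsilon> e mult"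
        and I: "left_ideal scale mult I"
        and sum: "?A = {p + x | p x. p \<in> primitives scale \<Delta> \<epsilon> e \<and> x \<in> I}"
        and direct: "primitives scale \<Delta> \<epsilon> e \<inter> I = {0}"
        unfolding LI_def by blast
      have "C.subspace I" using I by (simp add: left_ideal_def)
      \<comment> \<open>The preimage of \<open>(mult, I)\<close> is built from the projection onto
        the primitive elements whose kernel in \<open>A\<^sub>+\<close> is \<open>I\<close>.\<close>
      from this sum direct obtain \<pi> where \<pi>: "lin scale scale \<pi>" "\<And>a. \<pi> a \<in> primitives scale \<Delta> \<epsilon> e"
        "\<And>p. p \<in> primitives scale \<Delta> \<epsilon> e \<Longrightarrow> \<pi> p = p" "\<pi> e = 0"
        and I_eq: "I = {x \<in> ?A. \<pi> x = 0}"
        by (rule C.projection_along) blast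
      obtain R where "splitting scale \<Delta> \<epsilon> e \<pi> R"
        by (rule C.splitting_of_projection[OF \<pi>])
      then interpret X: splitting_hopf scale \<Delta> \<epsilon> e \<pi> R mult
        using hopf by (rule splitting_hopf.intro)
      have "\<pi> (mult a x) = 0" if "\<epsilon> x = 0" "\<pi> x = 0" for a x
      proof -
        have "mult a x \<in> I"
          using I that I_eq by (simp add: left_ideal_def augmentation_ideal_def)
        then show ?thesis unfolding I_eq by simp
      qed
      note D = X.dendriform_of_ideal[OF this]
      have "{(\<lambda>a\<in>?A. \<lambda>b\<in>?A. X.left_half a b) a b | a b. a \<in> ?A \<and> b \<in> ?A} =
          {X.left_half a b | a b. a \<in> ?A \<and> b \<in> ?A}"
        by fastforce
      then have "\<Phi> scale \<epsilon> e (\<lambda>a\<in>?A. \<lambda>b\<in>?A. X.left_half a b, \<lambda>a\<in>?A. \<lambda>b\<in>?A. X.right_half a b) = z"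
        by (simp only: Phi[OF D] z I_eq X.kernel_pi_eq_span)
      moreover have "(\<lambda>a\<in>?A. \<lambda>b\<in>?A. X.left_half a b, \<lambda>a\<in>?A. \<lambda>b\<in>?A. X.right_half a b) \<in> DD scale \<Delta> \<epsilon> e"
        using D unfolding DD_def by blast
      ultimately show "z \<in> \<Phi> scale \<epsilon> e ` DD scale \<Delta> \<epsilon> e" by blast
    qed
  qed
qed

end
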